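(* Let $V$ be a complex vector space of dimension $n$, and let $\lambda,\mu$ be partitions with at most $n$ rows such that $\mu$ is obtained from $\lambda$ by adding one box to the $k$th row, where $k\neq 1,n$. Then the $\mathbf{GL}(V)$-invariant tensor $T_{\lambda\mu}\in V\otimes \mathbf{S}_\lambda V\otimes \mathbf{S}_\mu V^*$ is not of minimal border rank.
   Context: $\mathbf{S}_\lambda V$ is the Schur functor applied to $V$, i.e. the irreducible polynomial representation of $\mathbf{GL}(V)$ of highest weight $\lambda$, with the convention $\mathbf{S}_{(d)}V=\mathrm{Sym}^dV$ and $\mathbf{S}_{(1^d)}V=\bigwedge^dV$. Since $\mu$ is obtained from $\lambda$ by adding a box, there is a unique up to scalar nonzero $\mathbf{GL}(V)$-equivariant (Pieri) map $\mathbf{S}_\mu V\to \mathbf{S}_\lambda V\otimes V$; $T_{\lambda\mu}\in V\otimes \mathbf{S}_\lambda V\otimes \mathbf{S}_\mu V^*$ is the corresponding tensor (well defined up to a nonzero scalar), where $\mathbf{S}_\mu V^*$ is the dual of $\mathbf{S}_\mu V$. For finite-dimensional complex vector spaces $A,B,C$, the rank of $T\in A\otimes B\otimes C$ is the smallest $r$ such that $T$ is a sum of $r$ tensors of the form $a\otimes b\otimes c$; the border rank $\underline{\mathrm{Rk}}(T)$ is the smallest $r$ such that $T$ lies in the closure of the set of tensors of rank at most $r$. $T$ is concise if the three induced maps $A^*\to B\otimes C$, $B^*\to A\otimes C$, $C^*\to A\otimes B$ are injective; then $\underline{\mathrm{Rk}}(T)\ge \max\{\dim A,\dim B,\dim C\}$,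 and a concise $T$ is of minimal border rank if equality holds. *)

theory Defs
  imports "HOL-Analysis.Analysis"
begin

text \<open>
  Throughout, \<open>V\<close> is the space \<open>complex^'n\<close>, and \<open>GL(V)\<close> is the set of invertible matrices
  in \<open>complex^'n^'n\<close>.  A finite-dimensional representation of \<open>GL(V)\<close> is given in a basis, as
  a map into \<open>complex^'w^'w\<close>; only its values on invertible matrices matter.
\<close>

section \<open>Polynomial representations of the general linear group\<close>

definition representation :: "(complex^'n^'n \<Rightarrow> complex^'w^'w) \<Rightarrow> bool" where
  "representation \<rho> \<longleftrightarrow>
     \<rho> (mat 1) = mat 1 \<and>
     (\<forall>g h. invertible g \<longrightarrow> invertible h \<longrightarrow> \<rho> (g ** h) = \<rho> g ** \<rho> h)"

inductive polynomial_in_entries :: "(complex^'n^'n \<Rightarrow> complex) \<Rightarrow> bool" where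
  const: "polynomial_in_entries (\<lambda>g. c)"
| entry: "polynomial_in_entries (\<lambda>g. g $ i $ j)"
| add: "polynomial_in_entries p \<Longrightarrow> polynomial_in_entries q \<Longrightarrow>
          polynomial_in_entries (\<lambda>g. p g + q g)"
| mult: "polynomial_in_entries p \<Longrightarrow> polynomial_in_entries q \<Longrightarrow>
          polynomial_in_entries (\<lambda>g. p g * q g)"

definition polynomial_representation :: "(complex^'n^'n \<Rightarrow> complex^'w^'w) \<Rightarrow> bool" where
  "polynomial_representation \<rho> \<longleftrightarrow>
     representation \<rho> \<and>
     (\<forall>i j. \<exists>p. polynomial_in_entries p \<and> (\<forall>g. invertible g \<longrightarrow> \<rho> g $ i $ j = p g))"

text \<open>The representation space is automatically nonzero, since index types are nonempty.\<close>

definition irreducible_representation :: "(complex^'n^'n \<Rightarrow> complex^'w^'w) \<Rightarrow> bool" where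
  "irreducible_representation \<rho> \<longleftrightarrow>
     representation \<rho> \<and>
     (\<forall>U. vec.subspace U \<longrightarrow> (\<forall>g. invertible g \<longrightarrow> (\<forall>u\<in>U. \<rho> g *v u \<in> U)) \<longrightarrow>
          U = {0} \<or> U = UNIV)"

definition ordered_basis :: "(nat \<Rightarrow> complex^'n) \<Rightarrow> bool" where
  "ordered_basis e \<longleftrightarrow>
     inj_on e {1..CARD('n)} \<and>
     vec.independent (e ` {1..CARD('n)}) \<and> vec.span (e ` {1..CARD('n)}) = UNIV"

text \<open>\<open>g\<close> is upper triangular in the ordered basis \<open>e\<close>, with diagonal entries \<open>t 1, t 2, \<dots>\<close>\<close>

definition upper_triangular_wrt ::
    "(nat \<Rightarrow> complex^'n) \<Rightarrow> (nat \<Rightarrow> complex) \<Rightarrow> complex^'n^'n \<Rightarrow> bool" where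
  "upper_triangular_wrt e t g \<longleftrightarrow>
     (\<forall>j\<in>{1..CARD('n)}. g *v e j - t j *s e j \<in> vec.span (e ` {1..<j}))"

text \<open>A nonzero eigenvector of the Borel subgroup of \<open>e\<close> on which the torus acts by \<open>lam\<close>\<close>

definition highest_weight_vector ::
    "(nat \<Rightarrow> complex^'n) \<Rightarrow> (complex^'n^'n \<Rightarrow> complex^'w^'w) \<Rightarrow> (nat \<Rightarrow> nat) \<Rightarrow>
     complex^'w \<Rightarrow> bool" where
  "highest_weight_vector e \<rho> lam w \<longleftrightarrow>
     w \<noteq> 0 \<and>
     (\<forall>g t. invertible g \<longrightarrow> upper_triangular_wrt e t g \<longrightarrow>
        \<rho> g *v w = (\<Prod>j=1..CARD('n). t j ^ lam j) *s w)"

text \<open>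
  The choice of ordered basis is immaterial, as \<open>GL(V)\<close> permutes the ordered bases
  transitively: if \<open>w\<close> works for \<open>e\<close>, then \<open>\<rho> h *v w\<close> works for \<open>\<lambda>j. h *v e j\<close>.
\<close>

definition has_highest_weight ::
    "(complex^'n^'n \<Rightarrow> complex^'w^'w) \<Rightarrow> (nat \<Rightarrow> nat) \<Rightarrow> bool" where
  "has_highest_weight \<rho> lam \<longleftrightarrow>
     (\<exists>e w. ordered_basis e \<and> highest_weight_vector e \<rho> lam w)"

section \<open>Partitions and Schur functors\<close>

text \<open>Row lengths are \<open>lam 1, lam 2, \<dots>\<close>; the value \<open>lam 0\<close> carries no meaning.\<close>

definition partition_with_rows :: "nat \<Rightarrow> (nat \<Rightarrow> nat) \<Rightarrow> bool" where
  "partition_with_rows n lam \<longleftrightarrow>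
     (\<forall>i j. 1 \<le> i \<longrightarrow> i \<le> j \<longrightarrow> lam j \<le> lam i) \<and> (\<forall>i>n. lam i = 0)"

definition adds_box :: "nat \<Rightarrow> (nat \<Rightarrow> nat) \<Rightarrow> (nat \<Rightarrow> nat) \<Rightarrow> bool" where
  "adds_box k lam mu \<longleftrightarrow>
     1 \<le> k \<and> (\<forall>i\<ge>1. mu i = (if i = k then lam i + 1 else lam i))"

text \<open>
  \<open>\<rho>\<close> is a model of the Schur functor of \<open>lam\<close> applied to \<open>V\<close>.  Such a \<open>\<rho>\<close> is unique up to isomorphism.  The weight
  \<open>(d)\<close> gives \<open>Sym\<^sup>d V\<close>, and the weight \<open>(1,\<dots>,1)\<close> with \<open>d\<close> ones gives the \<open>d\<close>-th exterior power.
\<close>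

definition schur_representation ::
    "(nat \<Rightarrow> nat) \<Rightarrow> (complex^'n^'n \<Rightarrow> complex^'w^'w) \<Rightarrow> bool" where
  "schur_representation lam \<rho> \<longleftrightarrow>
     polynomial_representation \<rho> \<and> irreducible_representation \<rho> \<and> has_highest_weight \<rho> lam"

section \<open>Pieri maps and their tensors\<close>

text \<open>
  The tensor product of \<open>complex^'l\<close> and \<open>complex^'n\<close> is \<open>complex^('l \<times> 'n)\<close>, where the coordinate
  \<open>(j, i)\<close> is the coefficient of \<open>axis j 1 \<otimes> axis i 1\<close>.
\<close>

definition kronecker :: "complex^'l^'l \<Rightarrow> complex^'n^'n \<Rightarrow> complex^('l \<times> 'n)^('l \<times> 'n)" where
  "kronecker A B = (\<chi> p q. A $ fst p $ fst q * B $ snd p $ snd q)"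

definition pieri_map ::
    "(complex^'n^'n \<Rightarrow> complex^'l^'l) \<Rightarrow> (complex^'n^'n \<Rightarrow> complex^'m^'m) \<Rightarrow>
     (complex^'m \<Rightarrow> complex^('l \<times> 'n)) \<Rightarrow> bool" where
  "pieri_map \<rho> \<sigma> P \<longleftrightarrow>
     Vector_Spaces.linear (*s) (*s) P \<and>
     (\<forall>g u. invertible g \<longrightarrow> P (\<sigma> g *v u) = kronecker (\<rho> g) g *v P u) \<and>
     (\<exists>u. P u \<noteq> 0)"

text \<open>
  An element of \<open>A \<otimes> B \<otimes> C\<close> is an array \<open>T $ i $ j $ k\<close> of type \<open>complex^'c^'b^'a\<close>.  For a linear map
  from \<open>complex^'m\<close> to \<open>complex^'l \<otimes> complex^'n\<close>, the corresponding tensor is the sum over \<open>k\<close> of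
  the image of the \<open>k\<close>-th basis vector tensored with the \<open>k\<close>-th dual basis vector.
\<close>

definition pieri_tensor :: "(complex^'m \<Rightarrow> complex^('l \<times> 'n)) \<Rightarrow> complex^'m^'l^'n" where
  "pieri_tensor P = (\<chi> i j k. P (axis k 1) $ (j, i))"

section \<open>Border rank\<close>

definition simple_tensor ::
    "complex^'a \<Rightarrow> complex^'b \<Rightarrow> complex^'c \<Rightarrow> complex^'c^'b^'a" where
  "simple_tensor a b c = (\<chi> i j k. a $ i * b $ j * c $ k)"

definition tensor_rank :: "complex^'c^'b^'a \<Rightarrow> nat" where
  "tensor_rank T = (LEAST r. \<exists>a b c. T = (\<Sum>s<r. simple_tensor (a s) (b s) (c s)))"

definition border_rank :: "complex^'c^'b^'a \<Rightarrow> nat" where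
  "border_rank T = (LEAST r. T \<in> closure {S. tensor_rank S \<le> r})"

definition concise :: "complex^'c^'b^'a \<Rightarrow> bool" where
  "concise T \<longleftrightarrow>
     inj (\<lambda>\<alpha>::complex^'a. (\<chi> j k. \<Sum>i\<in>UNIV. \<alpha> $ i * T $ i $ j $ k) :: complex^'c^'b) \<and>
     inj (\<lambda>\<beta>::complex^'b. (\<chi> i k. \<Sum>j\<in>UNIV. \<beta> $ j * T $ i $ j $ k) :: complex^'c^'a) \<and>
     inj (\<lambda>\<gamma>::complex^'c. (\<chi> i j. \<Sum>k\<in>UNIV. \<gamma> $ k * T $ i $ j $ k) :: complex^'b^'a)"

definition minimal_border_rank :: "complex^'c^'b^'a \<Rightarrow> bool" where
  "minimal_border_rank T \<longleftrightarrow>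
     concise T \<and> border_rank T = Max {CARD('a), CARD('b), CARD('c)}"

end

theory Submission imports Defs begin

text \<open>
  If a concise tensor \<open>T\<close> has minimal border rank, attained by the dimension of one of the factors,
  then the contractions of \<open>T\<close> with that factor include a nonzero tensor of rank one, as a limit of
  such contractions of tensors of rank at most that dimension.  For a Pieri map this is impossible:
  a decomposable vector \<open>w \<otimes> v\<close> in the image of \<open>\<sigma>\<close> would grow along the dilations \<open>1 + (t - 1) u f\<close>,
  where \<open>u f\<close> is a projection of rank one, like \<open>t\<close> to the power \<open>lam 1 + 1\<close>, while \<open>\<sigma>\<close> only grows like
  \<open>t\<close> to the power \<open>mu 1 = lam 1\<close>.  For the factor dual to \<open>\<rho>\<close> one compares with \<open>mu n = lam n\<close> as
  \<open>t\<close> tends to \<open>0\<close>.  For the factor \<open>V\<close>, transitivity of \<open>GL(V)\<close> on nonzero functionals makes all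
  contractions have rank one, which reduces to one of the other two cases.
\<close>

section \<open>Limits of tensors of low rank\<close>

text \<open>The expansion in standard basis tensors, with each entry absorbed into the third factor.
  It shows that the minimum in \<open>tensor_rank\<close> is taken over a nonempty set and so is
  attained.\<close>

lemma tensor_eq_sum_simple:
  fixes T :: "complex^'c^'b^'a"
  shows "\<exists>r a b c. T = (\<Sum>s<(r::nat). simple_tensor (a s) (b s) (c s))"
proof -
  obtain f :: "nat \<Rightarrow> 'a \<times> 'b \<times> 'c"
    where f: "bij_betw f {0..<card (UNIV :: ('a \<times> 'b \<times> 'c) set)} UNIV"
    using ex_bij_betw_nat_finite[OF finite] by blast
  let ?g = "\<lambda>(i, j, k). simple_tensor (axis i 1) (axis j 1) (axis k (T $ i $ j $ k))"
  have "T = (\<Sum>p\<in>UNIV. ?g p)"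
  proof (simp add: vec_eq_iff, intro allI)
    fix i j k
    have "(\<Sum>p\<in>UNIV. ?g p) $ i $ j $ k = (\<Sum>p\<in>UNIV. if p = (i, j, k) then T $ i $ j $ k else 0)"
      by (simp only: sum_component)
         (rule sum.cong, auto simp: simple_tensor_def axis_def split: prod.splits)
    then show "T $ i $ j $ k = (\<Sum>p\<in>UNIV. ?g p $ i $ j $ k)"
      by simp
  qed
  also have "\<dots> = (\<Sum>s<card (UNIV :: ('a \<times> 'b \<times> 'c) set). ?g (f s))"
    by (metis (no_types, lifting) atLeast0LessThan f sum.cong sum.reindex_bij_betw)
  also have "\<dots> = (\<Sum>s<card (UNIV :: ('a \<times> 'b \<times> 'c) set). simple_tensor (axis (fst (f s)) 1)
      (axis (fst (snd (f s))) 1) (axis (snd (snd (f s))) (T $ fst (f s) $ fst (snd (f s)) $ snd (snd (f s)))))"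
    by (simp add: case_prod_beta)
  finally show ?thesis by (intro exI)
qed

lemma tensor_rank_decomposition:
  fixes T :: "complex^'c^'b^'a"
  obtains a b c where "T = (\<Sum>s<tensor_rank T. simple_tensor (a s) (b s) (c s))"
proof -
  have "\<exists>a b c. T = (\<Sum>s<tensor_rank T. simple_tensor (a s) (b s) (c s))"
    unfolding tensor_rank_def by (rule LeastI_ex) (rule tensor_eq_sum_simple)
  then show thesis using that by blast
qed

lemma tensor_rank_le:
  "T = (\<Sum>s<r. simple_tensor (a s) (b s) (c s)) \<Longrightarrow> tensor_rank T \<le> r"
  unfolding tensor_rank_def by (rule Least_le) blast

lemma in_closure_border_rank:
  fixes T :: "complex^'c^'b^'a"
  shows "T \<in> closure {S. tensor_rank S \<le> border_rank T}"
  unfolding border_rank_def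
  by (rule LeastI_ex) (rule exI[of _ "tensor_rank T"], rule subsetD[OF closure_subset], simp)

section \<open>Cyclic permutation of the tensor factors\<close>

text \<open>Brings any chosen factor to the last place, so that slices need to be studied for the
  last factor only.\<close>

definition rotate_tensor :: "complex^'c^'b^'a \<Rightarrow> complex^'b^'a^'c" where
  "rotate_tensor T = (\<chi> k i j. T $ i $ j $ k)"

lemma rotate_tensor_nth [simp]: "rotate_tensor T $ k $ i $ j = T $ i $ j $ k"
  by (simp add: rotate_tensor_def)

lemma tensor_rank_rotate_le: "tensor_rank (rotate_tensor T) \<le> tensor_rank T"
proof -
  obtain a b c where abc: "T = (\<Sum>s<tensor_rank T. simple_tensor (a s) (b s) (c s))"
    by (rule tensor_rank_decomposition)
  have "rotate_tensor T = (\<Sum>s<tensor_rank T. simple_tensor (c s) (a s) (b s))"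
    by (subst abc) (simp add: vec_eq_iff simple_tensor_def mult_ac)
  then show ?thesis by (rule tensor_rank_le)
qed

lemma rotate_tensor_in_closure:
  fixes T :: "complex^'c^'b^'a"
  assumes "T \<in> closure {S. tensor_rank S \<le> r}"
  shows "rotate_tensor T \<in> closure {S. tensor_rank S \<le> r}"
proof -
  have "continuous_on (closure {S. tensor_rank S \<le> r}) (rotate_tensor :: complex^'c^'b^'a \<Rightarrow> _)"
    unfolding rotate_tensor_def by (intro continuous_intros)
  moreover have "rotate_tensor ` {S :: complex^'c^'b^'a. tensor_rank S \<le> r}
      \<subseteq> closure {S. tensor_rank S \<le> r}"
    using tensor_rank_rotate_le order_trans by (intro subset_trans[OF _ closure_subset]) blast
  ultimately have "rotate_tensor ` closure {S :: complex^'c^'b^'a. tensor_rank S \<le> r}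
      \<subseteq> closure {S. tensor_rank S \<le> r}"
    by (intro image_closure_subset) auto
  then show ?thesis using assms by blast
qed

section \<open>Slices of rank at most one\<close>

text \<open>Vanishing of the 2x2 minors is the form of "rank at most one" that passes to limits. A
  nonzero entry serves as pivot: its column times its normalised row recovers the matrix.\<close>

lemma outer_product_of_minors:
  fixes M :: "'a::finite \<Rightarrow> 'b::finite \<Rightarrow> complex"
  assumes minors: "\<And>i j i' j'. M i j * M i' j' = M i j' * M i' j"
  shows "\<exists>(a :: complex^'a) (b :: complex^'b). \<forall>i j. M i j = a $ i * b $ j"
proof (cases "\<exists>p q. M p q \<noteq> 0")
  case True
  then obtain p q where pq: "M p q \<noteq> 0" by blast
  have "M i j = (\<chi> i. M i q) $ i * (\<chi> j. M p j / M p q) $ j" for i j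
    using pq minors[of i j p q] by (simp add: field_simps)
  then show ?thesis by blast
next
  case False
  then have "M i j = (0::complex^'a) $ i * (0::complex^'b) $ j" for i j by simp
  then show ?thesis by blast
qed

text \<open>
  A decomposition with as many terms as the dimension of the last factor leaves a nonzero
  functional that kills all terms but the first; unit functionals of this kind accumulate.
\<close>

lemma slice_of_low_rank:
  fixes S :: "complex^'c^'b^'a"
  assumes "tensor_rank S \<le> CARD('c)"
  obtains \<gamma> :: "complex^'c" where "norm \<gamma> = 1"
    and "\<And>i j i' j'. (\<Sum>k\<in>UNIV. \<gamma> $ k * S $ i $ j $ k) * (\<Sum>k\<in>UNIV. \<gamma> $ k * S $ i' $ j' $ k)
        = (\<Sum>k\<in>UNIV. \<gamma> $ k * S $ i $ j' $ k) * (\<Sum>k\<in>UNIV. \<gamma> $ k * S $ i' $ j $ k)"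
proof -
  obtain a b c where abc: "S = (\<Sum>s<tensor_rank S. simple_tensor (a s) (b s) (c s))"
    by (rule tensor_rank_decomposition)
  obtain f :: "'c \<Rightarrow> nat" where f: "bij_betw f UNIV {0..<CARD('c)}"
    using ex_bij_betw_finite_nat[OF finite] by blast
  \<comment> \<open>The row with index 0 is set to zero, so \<open>A\<close> is singular; a nonzero
    kernel vector pairs to zero with every \<open>c s\<close> for
    \<open>0 < s < CARD('c)\<close>.\<close>
  define A :: "complex^'c^'c" where "A = (\<chi> q. if f q = 0 then 0 else c (f q))"
  obtain q0 where q0: "f q0 = 0"
    using bij_betw_imp_surj_on[OF f] by (metis (no_types) atLeastLessThan_iff imageE le0 zero_less_card_finite)
  have "row q0 A = 0" using q0 by (simp add: row_def A_def vec_eq_iff)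
  then have "det A = 0" by (rule det_zero_row)
  then have "\<not> invertible A" by (simp add: invertible_det_nz)
  then have "\<nexists>B. B ** A = mat 1"
    using invertible_def matrix_left_right_inverse by blast
  then obtain x where x: "A *v x = 0" "x \<noteq> 0"
    using matrix_left_invertible_ker[of A] by blast
  \<comment> \<open>Unit length keeps every limit of such functionals away from 0.\<close>
  define \<gamma> where "\<gamma> = inverse (norm x) *\<^sub>R x"
  have A\<gamma>: "A *v \<gamma> = 0" by (simp add: \<gamma>_def linear_cmul[OF matrix_vector_mul_linear] x)
  have kill: "(\<Sum>k\<in>UNIV. \<gamma> $ k * c s $ k) = 0" if s: "0 < s" "s < CARD('c)" for s
  proof -
    obtain q where q: "f q = s" using bij_betw_imp_surj_on[OF f] s by (metis atLeastLessThan_iff imageE le0)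
    have "(A *v \<gamma>) $ q = 0" using A\<gamma> by simp
    then show ?thesis using q s by (simp add: A_def matrix_vector_mult_def mult.commute)
  qed
  have slice: "\<exists>z. \<forall>i j. (\<Sum>k\<in>UNIV. \<gamma> $ k * S $ i $ j $ k) = z * (a 0 $ i * b 0 $ j)"
  proof (intro exI allI)
    fix i j
    have "(\<Sum>k\<in>UNIV. \<gamma> $ k * S $ i $ j $ k)
        = (\<Sum>k\<in>UNIV. \<Sum>s<tensor_rank S. \<gamma> $ k * (a s $ i * b s $ j * c s $ k))"
      by (subst abc) (simp add: simple_tensor_def sum_distrib_left)
    also have "\<dots> = (\<Sum>s<tensor_rank S. (\<Sum>k\<in>UNIV. \<gamma> $ k * c s $ k) * (a s $ i * b s $ j))"
      by (subst sum.swap) (simp add: sum_distrib_left sum_distrib_right mult_ac)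
    also have "\<dots> = (\<Sum>s<tensor_rank S. if s = 0 then
        (\<Sum>k\<in>UNIV. \<gamma> $ k * c 0 $ k) * (a 0 $ i * b 0 $ j) else 0)"
    proof (rule sum.cong[OF refl])
      fix s assume "s \<in> {..<tensor_rank S}"
      then have "(\<Sum>k\<in>UNIV. \<gamma> $ k * c s $ k) = 0" if "s \<noteq> 0"
        using kill[of s] that assms by simp
      then show "(\<Sum>k\<in>UNIV. \<gamma> $ k * c s $ k) * (a s $ i * b s $ j) = (if s = 0 then
        (\<Sum>k\<in>UNIV. \<gamma> $ k * c 0 $ k) * (a 0 $ i * b 0 $ j) else 0)"
        by auto
    qed
    \<comment> \<open>The sum is empty when the rank is 0, hence the case distinction.\<close>
    also have "\<dots> = (if 0 < tensor_rank S then (\<Sum>k\<in>UNIV. \<gamma> $ k * c 0 $ k) else 0)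
        * (a 0 $ i * b 0 $ j)"
      by (auto simp: sum.delta)
    finally show "(\<Sum>k\<in>UNIV. \<gamma> $ k * S $ i $ j $ k)
      = (if 0 < tensor_rank S then (\<Sum>k\<in>UNIV. \<gamma> $ k * c 0 $ k) else 0) * (a 0 $ i * b 0 $ j)" .
  qed
  show thesis
  proof (rule that)
    show "norm \<gamma> = 1" using x by (simp add: \<gamma>_def)
  next
    fix i j i' j'
    show "(\<Sum>k\<in>UNIV. \<gamma> $ k * S $ i $ j $ k) * (\<Sum>k\<in>UNIV. \<gamma> $ k * S $ i' $ j' $ k)
        = (\<Sum>k\<in>UNIV. \<gamma> $ k * S $ i $ j' $ k) * (\<Sum>k\<in>UNIV. \<gamma> $ k * S $ i' $ j $ k)"
      using slice by (auto simp: mult_ac)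
  qed
qed

text \<open>By compactness of the unit sphere, the functionals of the approximating tensors converge
  along a subsequence; the minors of the slices vanish along it and hence in the limit.\<close>

lemma rank_one_slice_of_limit:
  fixes T :: "complex^'c^'b^'a"
  assumes "T \<in> closure {S. tensor_rank S \<le> CARD('c)}"
  obtains \<gamma> :: "complex^'c" and a b where "\<gamma> \<noteq> 0"
    and "\<And>i j. (\<Sum>k\<in>UNIV. \<gamma> $ k * T $ i $ j $ k) = a $ i * b $ j"
proof -
  obtain X where X: "\<And>m. tensor_rank (X m) \<le> CARD('c)" "X \<longlonglongrightarrow> T"
    using assms unfolding closure_sequential by blast
  have "\<exists>\<gamma>. norm \<gamma> = 1 \<and> (\<forall>i j i' j'.
      (\<Sum>k\<in>UNIV. \<gamma> $ k * X m $ i $ j $ k) * (\<Sum>k\<in>UNIV. \<gamma> $ k * X m $ i' $ j' $ k)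
      = (\<Sum>k\<in>UNIV. \<gamma> $ k * X m $ i $ j' $ k) * (\<Sum>k\<in>UNIV. \<gamma> $ k * X m $ i' $ j $ k))" for m
    by (rule slice_of_low_rank[OF X(1)[of m]]) blast
  then have "\<forall>m. \<exists>\<gamma>. norm \<gamma> = 1 \<and> (\<forall>i j i' j'.
      (\<Sum>k\<in>UNIV. \<gamma> $ k * X m $ i $ j $ k) * (\<Sum>k\<in>UNIV. \<gamma> $ k * X m $ i' $ j' $ k)
      = (\<Sum>k\<in>UNIV. \<gamma> $ k * X m $ i $ j' $ k) * (\<Sum>k\<in>UNIV. \<gamma> $ k * X m $ i' $ j $ k))"
    by blast
  from choice[OF this] obtain g where g: "\<And>m. norm (g m) = 1" and minors: "\<And>m i j i' j'.
      (\<Sum>k\<in>UNIV. g m $ k * X m $ i $ j $ k) * (\<Sum>k\<in>UNIV. g m $ k * X m $ i' $ j' $ k)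
      = (\<Sum>k\<in>UNIV. g m $ k * X m $ i $ j' $ k) * (\<Sum>k\<in>UNIV. g m $ k * X m $ i' $ j $ k)"
    by blast
  have "seq_compact (sphere (0 :: complex^'c) 1)"
    by (rule compact_imp_seq_compact) (rule compact_sphere)
  moreover have "\<forall>m. g m \<in> sphere 0 1" using g by simp
  ultimately obtain \<gamma> and r :: "nat \<Rightarrow> nat"
    where \<gamma>: "\<gamma> \<in> sphere 0 1" "strict_mono r" "(g \<circ> r) \<longlonglongrightarrow> \<gamma>"
    by (rule seq_compactE)
  have Xr: "(X \<circ> r) \<longlonglongrightarrow> T" using X(2) \<gamma>(2) by (rule LIMSEQ_subseq_LIMSEQ)
  have lim: "(\<lambda>m. \<Sum>k\<in>UNIV. g (r m) $ k * X (r m) $ i $ j $ k)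
      \<longlonglongrightarrow> (\<Sum>k\<in>UNIV. \<gamma> $ k * T $ i $ j $ k)" for i j
    using \<gamma>(3) Xr by (intro tendsto_intros) (simp_all add: comp_def)
  have "(\<Sum>k\<in>UNIV. \<gamma> $ k * T $ i $ j $ k) * (\<Sum>k\<in>UNIV. \<gamma> $ k * T $ i' $ j' $ k)
      = (\<Sum>k\<in>UNIV. \<gamma> $ k * T $ i $ j' $ k) * (\<Sum>k\<in>UNIV. \<gamma> $ k * T $ i' $ j $ k)" for i j i' j'
    by (rule LIMSEQ_unique[OF tendsto_mult[OF lim lim]]) (subst minors, intro tendsto_mult lim)
  then have "\<exists>a b. \<forall>i j. (\<Sum>k\<in>UNIV. \<gamma> $ k * T $ i $ j $ k) = a $ i * b $ j"
    by (rule outer_product_of_minors)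
  then obtain a b where "\<And>i j. (\<Sum>k\<in>UNIV. \<gamma> $ k * T $ i $ j $ k) = a $ i * b $ j"
    by blast
  moreover have "\<gamma> \<noteq> 0" using \<gamma>(1) by auto
  ultimately show thesis by (intro that)
qed

text \<open>The maximum is the dimension of one of the factors. Two rotations bring the first factor
  to the last place, one rotation the second.\<close>

lemma minimal_border_rank_cases:
  fixes T :: "complex^'c^'b^'a"
  assumes "minimal_border_rank T"
  obtains (first) \<alpha> b c where "\<alpha> \<noteq> 0" "\<And>j k. (\<Sum>i\<in>UNIV. \<alpha> $ i * T $ i $ j $ k) = b $ j * c $ k"
  | (second) \<beta> a c where "\<beta> \<noteq> 0" "\<And>i k. (\<Sum>j\<in>UNIV. \<beta> $ j * T $ i $ j $ k) = a $ i * c $ k"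
  | (third) \<gamma> a b where "\<gamma> \<noteq> 0" "\<And>i j. (\<Sum>k\<in>UNIV. \<gamma> $ k * T $ i $ j $ k) = a $ i * b $ j"
proof -
  have "border_rank T = Max {CARD('a), CARD('b), CARD('c)}"
    using assms by (simp add: minimal_border_rank_def)
  then have T: "T \<in> closure {S. tensor_rank S \<le> Max {CARD('a), CARD('b), CARD('c)}}"
    using in_closure_border_rank[of T] by simp
  have "Max {CARD('a), CARD('b), CARD('c)} \<in> {CARD('a), CARD('b), CARD('c)}"
    by (rule Max_in) auto
  then consider "Max {CARD('a), CARD('b), CARD('c)} = CARD('a)"
    | "Max {CARD('a), CARD('b), CARD('c)} = CARD('b)"
    | "Max {CARD('a), CARD('b), CARD('c)} = CARD('c)" by auto
  then show thesis
  proof cases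
    case 1
    from T have "rotate_tensor (rotate_tensor T) \<in> closure {S. tensor_rank S \<le> CARD('a)}"
      unfolding 1 by (rule rotate_tensor_in_closure[OF rotate_tensor_in_closure])
    from rank_one_slice_of_limit[OF this] obtain \<alpha> b c where "\<alpha> \<noteq> 0"
      "\<And>j k. (\<Sum>i\<in>UNIV. \<alpha> $ i * rotate_tensor (rotate_tensor T) $ j $ k $ i) = b $ j * c $ k"
      by metis
    then show thesis using first[of \<alpha> b c] by simp
  next
    case 2
    from T have "rotate_tensor T \<in> closure {S. tensor_rank S \<le> CARD('b)}"
      unfolding 2 by (rule rotate_tensor_in_closure)
    from rank_one_slice_of_limit[OF this] obtain \<beta> a c
      where "\<beta> \<noteq> 0" "\<And>k i. (\<Sum>j\<in>UNIV. \<beta> $ j * rotate_tensor T $ k $ i $ j) = c $ k * a $ i"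
      by metis
    then show thesis using second[of \<beta> a c] by (simp add: mult.commute)
  next
    case 3
    from T have "T \<in> closure {S. tensor_rank S \<le> CARD('c)}" unfolding 3 .
    from rank_one_slice_of_limit[OF this] show thesis by (metis third)
  qed
qed

section \<open>Rank one perturbations of the identity\<close>

text \<open>Bilinear, without conjugation: vectors double as coordinates of functionals, on which
  matrices act from the right by \<open>v*\<close>.\<close>

definition pairing :: "complex^'n \<Rightarrow> complex^'n \<Rightarrow> complex" where
  "pairing f x = (\<Sum>i\<in>UNIV. f $ i * x $ i)"

lemma pairing_simps [simp]:
  "pairing (f + g) x = pairing f x + pairing g x"
  "pairing (f - g) x = pairing f x - pairing g x"
  "pairing (c *s f) x = c * pairing f x"
  "pairing 0 x = 0"
  "pairing f (x + y) = pairing f x + pairing f y"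
  "pairing f (x - y) = pairing f x - pairing f y"
  "pairing f (c *s x) = c * pairing f x"
  "pairing f 0 = 0"
  by (simp_all add: pairing_def sum.distrib sum_subtractf sum_distrib_left algebra_simps)

lemma pairing_axis [simp]: "pairing f (axis i 1) = f $ i" "pairing (axis i 1) x = x $ i"
  by (simp_all add: pairing_def axis_def if_distrib[of "\<lambda>z. _ * z"] if_distrib[of "\<lambda>z. z * _"] cong: if_cong)

lemma pairing_sum_right: "pairing f (sum h A) = (\<Sum>i\<in>A. pairing f (h i))"
  by (induction A rule: infinite_finite_induct) auto

lemma pairing_vector_matrix_mult [simp]: "pairing (f v* g) x = pairing f (g *v x)"
  unfolding pairing_def vector_matrix_mult_def matrix_vector_mult_def
  by (simp add: sum_distrib_left sum_distrib_right mult_ac) (rule sum.swap)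

lemma ex_pairing_right_eq_1: "f \<noteq> 0 \<Longrightarrow> \<exists>x. pairing f x = 1"
proof -
  assume "f \<noteq> 0"
  then obtain i where "f $ i \<noteq> 0" by (auto simp: vec_eq_iff)
  then have "pairing f ((1 / f $ i) *s axis i 1) = 1" by simp
  then show ?thesis by blast
qed

lemma ex_pairing_left_eq_1: "x \<noteq> 0 \<Longrightarrow> \<exists>f. pairing f x = 1"
  using ex_pairing_right_eq_1[of x] by (simp add: pairing_def mult.commute)

lemma norm_scalar_mult: "norm (c *s x) = norm c * norm (x :: complex^'n)"
  by (simp add: norm_vec_def L2_set_right_distrib norm_mult)

section \<open>Shears and dilations\<close>

text \<open>A transvection when \<open>pairing f u = 0\<close>; other values of the pairing are
  allowed, so that dilations are a special case.\<close>

definition shear :: "complex^'n \<Rightarrow> complex^'n \<Rightarrow> complex^'n^'n" where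
  "shear u f = mat 1 + (\<chi> i j. u $ i * f $ j)"

lemma shear_mult_vector [simp]: "shear u f *v x = x + pairing f x *s u"
  by (simp add: shear_def matrix_vector_mult_add_rdistrib)
     (simp add: vec_eq_iff matrix_vector_mult_def pairing_def sum_distrib_left sum_distrib_right mult_ac)

lemma vector_mult_shear [simp]: "h v* shear u f = h + pairing h u *s f"
  by (simp add: shear_def vector_matrix_mult_add_rdistrib)
     (simp add: vec_eq_iff vector_matrix_mult_def pairing_def sum_distrib_left sum_distrib_right mult_ac)

lemma shear_zero [simp]: "shear 0 f = mat 1"
  by (simp add: matrix_eq)

text \<open>The Sherman-Morrison formula for a rank one update of the identity.\<close>

lemma shear_inverse:
  assumes "1 + pairing f u \<noteq> 0"
  shows "shear u f ** shear (- (1 / (1 + pairing f u)) *s u) f = mat 1"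
    and "shear (- (1 / (1 + pairing f u)) *s u) f ** shear u f = mat 1"
  using assms
  by (simp_all add: matrix_eq vec_eq_iff field_simps flip: matrix_vector_mul_assoc)

lemma invertible_shear: "1 + pairing f u \<noteq> 0 \<Longrightarrow> invertible (shear u f)"
  using shear_inverse unfolding invertible_def by blast

text \<open>For \<open>pairing f u = 1\<close> this multiplies \<open>u\<close> by \<open>t\<close>
  and fixes the kernel of \<open>f\<close> pointwise, a conjugate of
  \<open>diag(t, 1, ..., 1)\<close>.\<close>

definition dilation :: "real \<Rightarrow> complex^'n \<Rightarrow> complex^'n \<Rightarrow> complex^'n^'n" where
  "dilation t u f = shear (complex_of_real (t - 1) *s u) f"

lemma invertible_dilation: "pairing f u = 1 \<Longrightarrow> t \<noteq> 0 \<Longrightarrow> invertible (dilation t u f)"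
  unfolding dilation_def by (rule invertible_shear) simp

lemma vector_mult_dilation:
  "pairing f u = 1 \<Longrightarrow> f v* dilation t u f = complex_of_real t *s f"
  by (simp add: dilation_def vec_eq_iff algebra_simps)

text \<open>Conjugating a dilation transports its vector and its functional. This is why growth
  statements that are to be carried along the group action must range over all pairs
  \<open>u\<close>, \<open>f\<close>.\<close>

lemma dilation_conjugate:
  assumes "g ** g' = mat 1"
  shows "dilation t u f ** g = g ** dilation t (g' *v u) (f v* g)"
proof -
  have "g *v (g' *v u) = u" by (simp add: matrix_vector_mul_assoc assms)
  then show ?thesis
    by (simp add: matrix_eq dilation_def vec.add vec.diff vec.scale vec_eq_iff algebra_simps flip: matrix_vector_mul_assoc)
qed

text \<open>As \<open>f\<close> kills \<open>u - u'\<close>, the left factor is a transvection. Its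
  coefficient \<open>1 - 1 / t\<close> has modulus at most 1 for \<open>t \<ge> 1\<close>, which
  suits estimates at infinity.\<close>

lemma dilation_eq_shear_mult_same_functional:
  assumes "pairing f u = 1" "pairing f u' = 1" "t \<noteq> 0"
  shows "dilation t u f = shear (complex_of_real (1 - 1 / t) *s (u - u')) f ** dilation t u' f"
  using assms
  by (simp add: matrix_eq dilation_def vec_eq_iff field_simps flip: matrix_vector_mul_assoc)

text \<open>Here \<open>f - f'\<close> kills \<open>u\<close>, and the coefficient
  \<open>t - 1\<close> has modulus at most 1 on \<open>{0<..1}\<close>, which suits estimates at
  zero.\<close>

lemma dilation_eq_shear_mult_same_vector:
  assumes "pairing f u = 1" "pairing f' u = 1"
  shows "dilation t u f = shear (complex_of_real (t - 1) *s u) (f - f') ** dilation t u f'"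
  using assms
  by (simp add: matrix_eq dilation_def vec_eq_iff algebra_simps flip: matrix_vector_mul_assoc)

section \<open>The dual basis of an ordered basis\<close>

lemma ordered_basis_dual:
  fixes e :: "nat \<Rightarrow> complex^'n"
  assumes e: "ordered_basis e"
  obtains \<phi> where
    "\<And>p q. p \<in> {1..CARD('n)} \<Longrightarrow> q \<in> {1..CARD('n)} \<Longrightarrow> pairing (\<phi> p) (e q) = (if p = q then 1 else 0)"
    and "\<And>x. x = (\<Sum>p\<in>{1..CARD('n)}. pairing (\<phi> p) x *s e p)"
proof -
  let ?B = "e ` {1..CARD('n)}"
  have ind: "vec.independent ?B" and span: "vec.span ?B = UNIV" and inj: "inj_on e {1..CARD('n)}"
    using e by (auto simp: ordered_basis_def)
  define \<phi> where "\<phi> p = (\<chi> i. vec.representation ?B (axis i 1) (e p))" for p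
  have rep: "pairing (\<phi> p) x = vec.representation ?B x (e p)" for p x
  proof -
    have "vec.representation ?B x (e p)
        = vec.representation ?B (\<Sum>i\<in>UNIV. x $ i *s axis i 1) (e p)"
      by (simp add: basis_expansion)
    also have "\<dots> = pairing (\<phi> p) x"
      by (subst vec.representation_sum[OF ind])
         (simp_all only: vec.representation_scale[OF ind] span UNIV_I \<phi>_def pairing_def
           vec_lambda_beta mult.commute)
    finally show ?thesis by simp
  qed
  show thesis
  proof (rule that)
    show "pairing (\<phi> p) (e q) = (if p = q then 1 else 0)"
      if "p \<in> {1..CARD('n)}" "q \<in> {1..CARD('n)}" for p q
    proof -
      have "vec.representation ?B (e q) = (\<lambda>b. if b = e q then 1 else 0)"
        using that by (intro vec.representation_basis[OF ind]) blast
      then show ?thesis using inj_on_eq_iff[OF inj that] by (simp add: rep)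
    qed
  next
    fix x
    have "(\<Sum>b\<in>?B. vec.representation ?B x b *s b) = x"
      by (rule vec.sum_representation_eq) (use ind span in auto)
    then show "x = (\<Sum>p\<in>{1..CARD('n)}. pairing (\<phi> p) x *s e p)"
      by (simp only: rep sum.reindex[OF inj] comp_def)
  qed
qed

section \<open>Growth along dilations\<close>

lemma continuous_on_polynomial_in_entries:
  "polynomial_in_entries p \<Longrightarrow> continuous_on UNIV p"
  by (induction rule: polynomial_in_entries.induct) (intro continuous_intros; assumption)+

text \<open>The values of \<open>\<rho>\<close> on singular matrices are arbitrary, so continuity is
  claimed for the matrix of polynomials that agrees with \<open>\<rho>\<close> on invertible
  ones.\<close>

lemma polynomial_representation_continuous:
  assumes "polynomial_representation \<rho>"
  obtains \<Phi> where "continuous_on UNIV \<Phi>" "\<And>g. invertible g \<Longrightarrow> \<rho> g = \<Phi> g"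
proof -
  have "\<forall>i j. \<exists>p. polynomial_in_entries p \<and> (\<forall>g. invertible g \<longrightarrow> \<rho> g $ i $ j = p g)"
    using assms by (simp add: polynomial_representation_def)
  then obtain p where p: "\<And>i j. polynomial_in_entries (p i j)"
    "\<And>i j g. invertible g \<Longrightarrow> \<rho> g $ i $ j = p i j g" by metis
  show thesis
  proof (rule that)
    show "continuous_on UNIV (\<lambda>g. \<chi> i j. p i j g)"
      by (intro continuous_intros continuous_on_polynomial_in_entries p)
    show "\<rho> g = (\<chi> i j. p i j g)" if "invertible g" for g
      using that p(2) by (simp add: vec_eq_iff)
  qed
qed

lemma continuous_on_matrix_vector_mult_left:
  fixes \<Phi> :: "'x::topological_space \<Rightarrow> complex^'n^'m"
  assumes "continuous_on S \<Phi>"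
  shows "continuous_on S (\<lambda>g. \<Phi> g *v w)"
  unfolding matrix_vector_mult_def using assms by (intro continuous_intros)

lemma continuous_shear_line: "continuous_on S (\<lambda>c. shear (c *s u) f)"
  unfolding shear_def vector_scalar_mult_def by (intro continuous_intros)

text \<open>Transvections with coefficient in the closed unit disc form a compact set of invertible
  matrices.\<close>

lemma polynomial_representation_shear_bounded:
  assumes "polynomial_representation \<rho>" "pairing f u = 0"
  obtains K where "\<And>c. norm c \<le> 1 \<Longrightarrow> norm (\<rho> (shear (c *s u) f) *v w) \<le> K"
proof -
  obtain \<Phi> where \<Phi>: "continuous_on UNIV \<Phi>" "\<And>g. invertible g \<Longrightarrow> \<rho> g = \<Phi> g"
    using polynomial_representation_continuous[OF assms(1)] by blast
  have "continuous_on (cball 0 1) (\<lambda>c. \<Phi> (shear (c *s u) f) *v w)"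
    by (intro continuous_on_matrix_vector_mult_left continuous_on_compose2[OF \<Phi>(1)] continuous_shear_line)
       auto
  then have "bounded ((\<lambda>c. \<Phi> (shear (c *s u) f) *v w) ` cball 0 1)"
    by (intro compact_imp_bounded compact_continuous_image) auto
  then obtain K where "\<And>c. norm c \<le> 1 \<Longrightarrow> norm (\<Phi> (shear (c *s u) f) *v w) \<le> K"
    unfolding bounded_iff by (metis imageI mem_cball_0)
  moreover have "\<rho> (shear (c *s u) f) = \<Phi> (shear (c *s u) f)" for c
    using assms(2) by (intro \<Phi>(2) invertible_shear) simp
  ultimately show thesis by (intro that) simp
qed

text \<open>Serves to perturb a vector by group elements near the identity; shears with small
  coefficient are invertible for any value of \<open>pairing f u\<close>.\<close>

lemma polynomial_representation_shear_tendsto: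
  assumes "polynomial_representation \<rho>"
  shows "((\<lambda>c. \<rho> (shear (c *s u) f) *v w) \<longlongrightarrow> w) (at 0)"
proof -
  obtain \<Phi> where \<Phi>: "continuous_on UNIV \<Phi>" "\<And>g. invertible g \<Longrightarrow> \<rho> g = \<Phi> g"
    using polynomial_representation_continuous[OF assms] by blast
  have "continuous_on UNIV (\<lambda>c. \<Phi> (shear (c *s u) f) *v w)"
    by (intro continuous_on_matrix_vector_mult_left continuous_on_compose2[OF \<Phi>(1)] continuous_shear_line)
       auto
  then have "((\<lambda>c. \<Phi> (shear (c *s u) f) *v w) \<longlongrightarrow> \<Phi> (shear (0 *s u) f) *v w) (at 0)"
    unfolding continuous_on_def by (metis UNIV_I)
  moreover have "\<Phi> (shear (0 *s u) f) = mat 1"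
    using \<Phi>(2)[OF invertible_shear, of f 0] assms
    by (simp add: shear_zero polynomial_representation_def representation_def)
  moreover have "\<forall>\<^sub>F c in at 0. 1 + c * pairing f u \<noteq> 0"
  proof -
    have "((\<lambda>c. 1 + c * pairing f u) \<longlongrightarrow> 1 + 0 * pairing f u) (at 0)" by (intro tendsto_intros)
    then show ?thesis by (rule tendsto_imp_eventually_ne) simp
  qed
  then have "\<forall>\<^sub>F c in at 0. \<Phi> (shear (c *s u) f) *v w = \<rho> (shear (c *s u) f) *v w"
    by eventually_elim (simp add: \<Phi>(2) invertible_shear)
  ultimately show ?thesis by (simp add: filterlim_cong)
qed

section \<open>Spreading bounds by irreducibility\<close>

lemma representation_mult_vector:
  "representation \<rho> \<Longrightarrow> invertible g \<Longrightarrow> invertible h \<Longrightarrow> \<rho> (g ** h) *v x = \<rho> g *v (\<rho> h *v x)"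
  by (simp add: representation_def matrix_vector_mul_assoc)

text \<open>Irreducibility as an induction rule: the vectors with property \<open>Q\<close> form an
  invariant subspace, nonzero because it contains \<open>w\<close>.\<close>

lemma irreducible_representation_induct [consumes 2, case_names 0 add scale act start]:
  assumes "irreducible_representation \<rho>" "w \<noteq> 0"
    and "Q 0" "\<And>x y. Q x \<Longrightarrow> Q y \<Longrightarrow> Q (x + y)" "\<And>c x. Q x \<Longrightarrow> Q (c *s x)"
    and "\<And>g x. invertible g \<Longrightarrow> Q x \<Longrightarrow> Q (\<rho> g *v x)" "Q w"
  shows "Q x"
proof -
  have "vec.subspace {x. Q x}" using assms by (simp add: vec.subspace_def)
  moreover have "\<forall>g. invertible g \<longrightarrow> (\<forall>u\<in>{x. Q x}. \<rho> g *v u \<in> {x. Q x})" using assms by simp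
  ultimately have "{x. Q x} = {0} \<or> {x. Q x} = UNIV"
    using assms(1) unfolding irreducible_representation_def by blast
  then show ?thesis using assms(2,7) by blast
qed

text \<open>The vectors satisfying the bound for all pairs \<open>u\<close>, \<open>f\<close> form
  an invariant subspace: acting by \<open>g\<close> conjugates the dilation and costs only the
  operator norm of \<open>\<rho> g\<close>.\<close>

lemma dilation_growth:
  fixes \<rho> :: "complex^'n^'n \<Rightarrow> complex^'l^'l"
  assumes irr: "irreducible_representation \<rho>" and "w \<noteq> 0" and pos: "\<And>t. t \<in> S \<Longrightarrow> 0 < t"
    and w: "\<And>u f. pairing f u = 1 \<Longrightarrow> \<exists>K. \<forall>t\<in>S. norm (\<rho> (dilation t u f) *v w) \<le> K * t ^ d"
    and uf: "pairing f u = 1"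
  shows "\<exists>K. \<forall>t\<in>S. norm (\<rho> (dilation t u f) *v x) \<le> K * t ^ d"
proof -
  have rep: "representation \<rho>" using irr by (simp add: irreducible_representation_def)
  have "\<forall>u f. pairing f u = 1 \<longrightarrow> (\<exists>K. \<forall>t\<in>S. norm (\<rho> (dilation t u f) *v x) \<le> K * t ^ d)"
    using irr \<open>w \<noteq> 0\<close>
  proof (induction rule: irreducible_representation_induct)
    case 0
    show ?case by (auto intro!: exI[of _ 0])
  next
    case (add x y)
    show ?case
    proof (intro allI impI)
      fix u f :: "complex^'n" assume "pairing f u = 1"
      then obtain K L where K: "\<And>t. t \<in> S \<Longrightarrow> norm (\<rho> (dilation t u f) *v x) \<le> K * t ^ d"
        and L: "\<And>t. t \<in> S \<Longrightarrow> norm (\<rho> (dilation t u f) *v y) \<le> L * t ^ d"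
        using add by meson
      show "\<exists>K. \<forall>t\<in>S. norm (\<rho> (dilation t u f) *v (x + y)) \<le> K * t ^ d"
        by (rule exI[of _ "K + L"])
           (auto simp: vec.add distrib_right intro!: norm_triangle_le add_mono K L)
    qed
  next
    case (scale c x)
    show ?case
    proof (intro allI impI)
      fix u f :: "complex^'n" assume "pairing f u = 1"
      then obtain K where K: "\<And>t. t \<in> S \<Longrightarrow> norm (\<rho> (dilation t u f) *v x) \<le> K * t ^ d"
        using scale by meson
      show "\<exists>K. \<forall>t\<in>S. norm (\<rho> (dilation t u f) *v (c *s x)) \<le> K * t ^ d"
        by (rule exI[of _ "norm c * K"])
           (auto simp: vec.scale norm_scalar_mult mult.assoc intro!: mult_left_mono K)
    qed
  next
    case (act g x)
    show ?case
    proof (intro allI impI)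
      fix u f :: "complex^'n" assume uf: "pairing f u = 1"
      obtain g' where g': "g ** g' = mat 1" "g' ** g = mat 1" using act(1) by (auto simp: invertible_def)
      have uf': "pairing (f v* g) (g' *v u) = 1" by (simp add: matrix_vector_mul_assoc g' uf)
      then obtain K where K: "\<And>t. t \<in> S \<Longrightarrow> norm (\<rho> (dilation t (g' *v u) (f v* g)) *v x) \<le> K * t ^ d"
        using act(2) by meson
      obtain B where B: "B > 0" "\<And>x. norm (\<rho> g *v x) \<le> norm x * B"
        using bounded_linear.pos_bounded[OF matrix_vector_mul_bounded_linear] by blast
      have "norm (\<rho> (dilation t u f) *v (\<rho> g *v x)) \<le> (K * B) * t ^ d" if t: "t \<in> S" for t
      proof -
        have "\<rho> (dilation t u f) *v (\<rho> g *v x) = \<rho> (dilation t u f ** g) *v x"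
          using pos[OF t] act(1) uf by (simp add: representation_mult_vector[OF rep] invertible_dilation)
        also have "\<dots> = \<rho> g *v (\<rho> (dilation t (g' *v u) (f v* g)) *v x)"
          using pos[OF t] act(1) uf'
          by (simp add: dilation_conjugate[OF g'(1)] representation_mult_vector[OF rep] invertible_dilation
              del: pairing_vector_matrix_mult)
        also have "norm \<dots> \<le> (K * t ^ d) * B"
          using B K[OF t] by (meson less_eq_real_def mult_right_mono order_trans)
        finally show ?thesis by (simp add: mult_ac)
      qed
      then show "\<exists>K. \<forall>t\<in>S. norm (\<rho> (dilation t u f) *v (\<rho> g *v x)) \<le> K * t ^ d" by blast
    qed
  next
    case start
    show ?case using w by blast
  qed
  then show ?thesis using uf by blast
qed

text \<open>
  The two estimates for a highest weight vector come from factoring a dilation as a bounded shear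
  times a dilation that is upper triangular.
\<close>

lemma highest_weight_vector_upper_triangular:
  fixes \<rho> :: "complex^'n^'n \<Rightarrow> complex^'w^'w"
  assumes w: "highest_weight_vector e \<rho> lam w" and "invertible g" and p: "p \<in> {1..CARD('n)}"
    and g: "upper_triangular_wrt e (\<lambda>i. if i = p then c else 1) g"
  shows "\<rho> g *v w = c ^ lam p *s w"
proof -
  have "\<rho> g *v w = (\<Prod>j=1..CARD('n). (if j = p then c else 1) ^ lam j) *s w"
    using assms by (simp add: highest_weight_vector_def)
  also have "(\<Prod>j=1..CARD('n). (if j = p then c else 1) ^ lam j) = (\<Prod>j=1..CARD('n). if j = p then c ^ lam p else 1)"
    by (rule prod.cong) auto
  also have "\<dots> = c ^ lam p" using p by (simp add: prod.delta)
  finally show ?thesis .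
qed

section \<open>Dilations that are upper triangular\<close>

text \<open>The dilation displaces vectors only along \<open>e j\<close>: it fixes
  \<open>e i\<close> for \<open>i < j\<close>, scales \<open>e j\<close>, and changes later basis
  vectors by a multiple of the earlier \<open>e j\<close>.\<close>

lemma dilation_upper_triangular_functional:
  fixes e :: "nat \<Rightarrow> complex^'n"
  assumes "j \<in> {1..CARD('n)}" "pairing f (e j) \<noteq> 0" "\<And>i. i \<in> {1..<j} \<Longrightarrow> pairing f (e i) = 0"
  shows "upper_triangular_wrt e (\<lambda>i. if i = j then complex_of_real t else 1)
    (dilation t ((1 / pairing f (e j)) *s e j) f)"
  unfolding upper_triangular_wrt_def
proof
  fix i assume i: "i \<in> {1..CARD('n)}"
  have d: "dilation t ((1 / pairing f (e j)) *s e j) f *v e i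
      = e i + (complex_of_real (t - 1) * pairing f (e i) / pairing f (e j)) *s e j"
    by (simp add: dilation_def vec_eq_iff field_simps)
  consider "i < j" | "i = j" | "j < i" by linarith
  then show "dilation t ((1 / pairing f (e j)) *s e j) f *v e i
      - (if i = j then complex_of_real t else 1) *s e i \<in> vec.span (e ` {1..<i})"
  proof cases
    case 1
    then have "pairing f (e i) = 0" using assms i by auto
    then show ?thesis using 1 by (simp add: d vec.span_zero)
  next
    case 2
    then have "e i + (complex_of_real (t - 1) * pairing f (e i) / pairing f (e j)) *s e j
      - complex_of_real t *s e i = 0"
      using assms(2) by (simp add: vec_eq_iff field_simps)
    then have "dilation t ((1 / pairing f (e j)) *s e j) f *v e i
      - (if i = j then complex_of_real t else 1) *s e i = 0"
      unfolding d using 2 by simp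
    then show ?thesis by (simp only: vec.span_zero)
  next
    case 3
    then have "e j \<in> vec.span (e ` {1..<i})" using assms by (auto intro: vec.span_base)
    then show ?thesis using 3 by (simp add: d vec.span_scale)
  qed
qed

text \<open>Among the basis vectors only \<open>e j\<close> is moved, by a multiple of
  \<open>u\<close>, and \<open>u\<close> lies in the span of \<open>e 1, ..., e j\<close>.\<close>

lemma dilation_upper_triangular_vector:
  fixes e :: "nat \<Rightarrow> complex^'n"
  assumes j: "j \<in> {1..CARD('n)}" and "pairing (\<phi> j) u \<noteq> 0"
    and "\<And>i. i \<in> {1..CARD('n)} \<Longrightarrow> j < i \<Longrightarrow> pairing (\<phi> i) u = 0"
    and dual: "\<And>p q. p \<in> {1..CARD('n)} \<Longrightarrow> q \<in> {1..CARD('n)} \<Longrightarrow>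
      pairing (\<phi> p) (e q) = (if p = q then 1 else 0)"
    and expand: "\<And>x. x = (\<Sum>p\<in>{1..CARD('n)}. pairing (\<phi> p) x *s e p)"
  shows "upper_triangular_wrt e (\<lambda>i. if i = j then complex_of_real t else 1)
    (dilation t u ((1 / pairing (\<phi> j) u) *s \<phi> j))"
  unfolding upper_triangular_wrt_def
proof
  fix i assume i: "i \<in> {1..CARD('n)}"
  have d: "dilation t u ((1 / pairing (\<phi> j) u) *s \<phi> j) *v e i
      = e i + (if i = j then (complex_of_real (t - 1) / pairing (\<phi> j) u) *s u else 0)"
    using dual[OF j i] assms(2) by (auto simp add: dilation_def vec_eq_iff field_simps)
  show "dilation t u ((1 / pairing (\<phi> j) u) *s \<phi> j) *v e i
      - (if i = j then complex_of_real t else 1) *s e i \<in> vec.span (e ` {1..<i})"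
  proof (cases "i = j")
    case False
    then show ?thesis by (simp add: d vec.span_zero)
  next
    case True
    have "u = (\<Sum>p\<in>{1..CARD('n)}. pairing (\<phi> p) u *s e p)" by (rule expand)
    also have "\<dots> = (\<Sum>p\<in>{1..j}. pairing (\<phi> p) u *s e p)"
      using j assms(3) by (intro sum.mono_neutral_right) auto
    also have "{1..j} = insert j {1..<j}" using j by auto
    finally have u: "u = pairing (\<phi> j) u *s e j + (\<Sum>p\<in>{1..<j}. pairing (\<phi> p) u *s e p)"
      by simp
    have "(complex_of_real (t - 1) / pairing (\<phi> j) u) *s u = complex_of_real (t - 1) *s e j
      + (complex_of_real (t - 1) / pairing (\<phi> j) u) *s (\<Sum>p\<in>{1..<j}. pairing (\<phi> p) u *s e p)"
      \<comment> \<open>Only the occurrence of \<open>u\<close> outside the scalar is expanded, so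
        that \<open>pairing (\<phi> j) u\<close> cancels.\<close>
      by (subst (2) u) (use assms(2) in \<open>simp add: vec.scale_right_distrib\<close>)
    then have "dilation t u ((1 / pairing (\<phi> j) u) *s \<phi> j) *v e i - complex_of_real t *s e i
      = (complex_of_real (t - 1) / pairing (\<phi> j) u) *s (\<Sum>p\<in>{1..<j}. pairing (\<phi> p) u *s e p)"
      unfolding d by (simp add: True vec_eq_iff algebra_simps)
    moreover have "\<dots> \<in> vec.span (e ` {1..<j})"
      by (intro vec.span_scale vec.span_sum) (auto intro: vec.span_base)
    ultimately show ?thesis by (simp add: True)
  qed
qed

section \<open>Growth bounds and their sharpness\<close>

lemma highest_weight_vector_growth_at_infinity:
  fixes \<rho> :: "complex^'n^'n \<Rightarrow> complex^'w^'w"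
  assumes \<rho>: "polynomial_representation \<rho>" and e: "ordered_basis e"
    and w: "highest_weight_vector e \<rho> lam w"
    and lam: "\<And>j. j \<in> {1..CARD('n)} \<Longrightarrow> lam j \<le> d" and uf: "pairing f u = 1"
  shows "\<exists>K. \<forall>t\<in>{1..}. norm (\<rho> (dilation t u f) *v w) \<le> K * t ^ d"
proof -
  have rep: "representation \<rho>" using \<rho> by (simp add: polynomial_representation_def)
  obtain \<phi> where expand: "\<And>x. x = (\<Sum>p\<in>{1..CARD('n)}. pairing (\<phi> p) x *s e p)"
    using ordered_basis_dual[OF e] by metis
  have "\<exists>p\<in>{1..CARD('n)}. pairing f (e p) \<noteq> 0"
  proof (rule ccontr)
    assume "\<not> ?thesis"
    then have "pairing f (\<Sum>p\<in>{1..CARD('n)}. pairing (\<phi> p) u *s e p) = 0"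
      by (simp add: pairing_sum_right)
    then show False using uf expand[of u] by simp
  qed
  \<comment> \<open>Taking the first index where \<open>f\<close> is nonzero makes the dilation
    along \<open>e j\<close> upper triangular; \<open>f\<close> is kept and \<open>u\<close> is
    replaced by a multiple of \<open>e j\<close>.\<close>
  then obtain j where j: "j \<in> {1..CARD('n)}" "pairing f (e j) \<noteq> 0"
    and first: "\<And>i. i < j \<Longrightarrow> \<not> (i \<in> {1..CARD('n)} \<and> pairing f (e i) \<noteq> 0)"
    using exists_least_iff[of "\<lambda>p. p \<in> {1..CARD('n)} \<and> pairing f (e p) \<noteq> 0"] by blast
  define u' where "u' = (1 / pairing f (e j)) *s e j"
  have u': "pairing f u' = 1" using j by (simp add: u'_def)
  obtain K where K: "\<And>c. norm c \<le> 1 \<Longrightarrow> norm (\<rho> (shear (c *s (u - u')) f) *v w) \<le> K"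
    using polynomial_representation_shear_bounded[OF \<rho>, of f "u - u'" w] uf u'
    by (metis diff_self pairing_simps(6))
  have "norm (\<rho> (dilation t u f) *v w) \<le> K * t ^ d" if t: "1 \<le> t" for t
  proof -
    let ?s = "shear (complex_of_real (1 - 1 / t) *s (u - u')) f"
    have b: "\<rho> (dilation t u' f) *v w = complex_of_real t ^ lam j *s w"
      unfolding u'_def using t j first
      by (intro highest_weight_vector_upper_triangular[OF w _ j(1)] dilation_upper_triangular_functional
          invertible_dilation) auto
    have "invertible ?s" using uf u' by (intro invertible_shear) simp
    then have "\<rho> (dilation t u f) *v w = \<rho> ?s *v (\<rho> (dilation t u' f) *v w)"
      using t uf u'
      by (simp add: dilation_eq_shear_mult_same_functional[OF uf u'] representation_mult_vector[OF rep]
          invertible_dilation)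
    also have "norm \<dots> = t ^ lam j * norm (\<rho> ?s *v w)"
      using t by (simp add: b vec.scale norm_scalar_mult norm_power)
    also have "\<dots> \<le> t ^ d * K"
    proof (intro mult_mono)
      show "t ^ lam j \<le> t ^ d" using t lam[OF j(1)] by (simp add: power_increasing)
      have "norm (complex_of_real (1 - 1 / t)) \<le> 1"
        unfolding norm_of_real using t by (simp add: field_simps)
      then show "norm (\<rho> ?s *v w) \<le> K" by (rule K)
    qed (use t in auto)
    finally show ?thesis by (simp add: mult.commute)
  qed
  then show ?thesis by auto
qed

lemma highest_weight_vector_growth_at_zero:
  fixes \<rho> :: "complex^'n^'n \<Rightarrow> complex^'w^'w"
  assumes \<rho>: "polynomial_representation \<rho>" and e: "ordered_basis e"
    and w: "highest_weight_vector e \<rho> lam w"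
    and lam: "\<And>j. j \<in> {1..CARD('n)} \<Longrightarrow> d \<le> lam j" and uf: "pairing f u = 1"
  shows "\<exists>K. \<forall>t\<in>{0<..1}. norm (\<rho> (dilation t u f) *v w) \<le> K * t ^ d"
proof -
  have rep: "representation \<rho>" using \<rho> by (simp add: polynomial_representation_def)
  obtain \<phi> where dual: "\<And>p q. p \<in> {1..CARD('n)} \<Longrightarrow> q \<in> {1..CARD('n)} \<Longrightarrow>
      pairing (\<phi> p) (e q) = (if p = q then 1 else 0)"
    and expand: "\<And>x. x = (\<Sum>p\<in>{1..CARD('n)}. pairing (\<phi> p) x *s e p)"
    using ordered_basis_dual[OF e] by metis
  let ?J = "{p \<in> {1..CARD('n)}. pairing (\<phi> p) u \<noteq> 0}"
  have "?J \<noteq> {}"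
  proof
    assume "?J = {}"
    then have "(\<Sum>p\<in>{1..CARD('n)}. pairing (\<phi> p) u *s e p) = 0"
      by (intro sum.neutral) auto
    then show False using uf expand[of u] by simp
  qed
  \<comment> \<open>The mirror choice: with the last nonzero coordinate of \<open>u\<close>, the
    vector is kept and \<open>f\<close> is replaced by a multiple of
    \<open>\<phi> j\<close>.\<close>
  define j where "j = Max ?J"
  have "j \<in> ?J" unfolding j_def by (rule Max_in) (use \<open>?J \<noteq> {}\<close> in auto)
  then have j: "j \<in> {1..CARD('n)}" "pairing (\<phi> j) u \<noteq> 0" by auto
  have last: "pairing (\<phi> i) u = 0" if "i \<in> {1..CARD('n)}" "j < i" for i
  proof (rule ccontr)
    assume "pairing (\<phi> i) u \<noteq> 0"
    then have "i \<le> j" unfolding j_def using that by (intro Max_ge) auto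
    then show False using that by simp
  qed
  define f' where "f' = (1 / pairing (\<phi> j) u) *s \<phi> j"
  have f': "pairing f' u = 1" using j by (simp add: f'_def)
  obtain K where K: "\<And>c. norm c \<le> 1 \<Longrightarrow> norm (\<rho> (shear (c *s u) (f - f')) *v w) \<le> K"
    using polynomial_representation_shear_bounded[OF \<rho>, of "f - f'" u w] uf f'
    by (metis diff_self pairing_simps(2))
  have "norm (\<rho> (dilation t u f) *v w) \<le> K * t ^ d" if t: "0 < t" "t \<le> 1" for t
  proof -
    let ?s = "shear (complex_of_real (t - 1) *s u) (f - f')"
    have b: "\<rho> (dilation t u f') *v w = complex_of_real t ^ lam j *s w"
      unfolding f'_def using t j
      by (intro highest_weight_vector_upper_triangular[OF w _ j(1)]
          dilation_upper_triangular_vector[OF j last dual expand] invertible_dilation) auto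
    have "invertible ?s" using uf f' by (intro invertible_shear) simp
    then have "\<rho> (dilation t u f) *v w = \<rho> ?s *v (\<rho> (dilation t u f') *v w)"
      using t f'
      by (simp add: dilation_eq_shear_mult_same_vector[OF uf f'] representation_mult_vector[OF rep]
          invertible_dilation)
    also have "norm \<dots> = t ^ lam j * norm (\<rho> ?s *v w)"
      using t by (simp add: b vec.scale norm_scalar_mult norm_power)
    also have "\<dots> \<le> t ^ d * K"
    proof (intro mult_mono)
      show "t ^ lam j \<le> t ^ d" using t lam[OF j(1)] by (simp add: power_decreasing)
      have "norm (complex_of_real (t - 1)) \<le> 1"
        unfolding norm_of_real using t by simp
      then show "norm (\<rho> ?s *v w) \<le> K" by (rule K)
    qed (use t in auto)
    finally show ?thesis by (simp add: mult.commute)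
  qed
  then show ?thesis by (intro exI[of _ K]) auto
qed

text \<open>A substitute for weight spaces: dilations act with exponents between the smallest and
  the largest row of \<open>lam\<close>.\<close>

lemma schur_representation_dilation_bound:
  fixes \<rho> :: "complex^'n^'n \<Rightarrow> complex^'l^'l"
  assumes \<rho>: "schur_representation lam \<rho>" and uf: "pairing f u = 1"
  shows "(\<And>j. j \<in> {1..CARD('n)} \<Longrightarrow> lam j \<le> d) \<Longrightarrow>
      \<exists>K. \<forall>t\<in>{1..}. norm (\<rho> (dilation t u f) *v x) \<le> K * t ^ d"
    and "(\<And>j. j \<in> {1..CARD('n)} \<Longrightarrow> d \<le> lam j) \<Longrightarrow>
      \<exists>K. \<forall>t\<in>{0<..1}. norm (\<rho> (dilation t u f) *v x) \<le> K * t ^ d"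
proof -
  obtain e w where ew: "ordered_basis e" "highest_weight_vector e \<rho> lam w"
    and \<rho>': "polynomial_representation \<rho>" "irreducible_representation \<rho>"
    using \<rho> by (auto simp: schur_representation_def has_highest_weight_def)
  have w: "w \<noteq> 0" using ew by (simp add: highest_weight_vector_def)
  show "\<exists>K. \<forall>t\<in>{1..}. norm (\<rho> (dilation t u f) *v x) \<le> K * t ^ d"
    if "\<And>j. j \<in> {1..CARD('n)} \<Longrightarrow> lam j \<le> d"
    by (rule dilation_growth[OF \<rho>'(2) w _ _ uf])
       (use highest_weight_vector_growth_at_infinity[OF \<rho>'(1) ew that] in auto)
  show "\<exists>K. \<forall>t\<in>{0<..1}. norm (\<rho> (dilation t u f) *v x) \<le> K * t ^ d"
    if "\<And>j. j \<in> {1..CARD('n)} \<Longrightarrow> d \<le> lam j"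
    by (rule dilation_growth[OF \<rho>'(2) w _ _ uf])
       (use highest_weight_vector_growth_at_zero[OF \<rho>'(1) ew that] in auto)
qed

text \<open>A highest weight vector and the dilation along \<open>e p\<close> with dual functional
  \<open>\<phi> p\<close>. The cases of the first and last row show that the growth bounds are
  sharp.\<close>

lemma schur_representation_dilation_eigenvector:
  fixes \<rho> :: "complex^'n^'n \<Rightarrow> complex^'l^'l"
  assumes \<rho>: "schur_representation lam \<rho>" and p: "p \<in> {1..CARD('n)}"
  obtains u f w where "w \<noteq> 0" "pairing f u = 1"
    "\<And>t. 0 < t \<Longrightarrow> \<rho> (dilation t u f) *v w = complex_of_real t ^ lam p *s w"
proof -
  obtain e w where ew: "ordered_basis e" "highest_weight_vector e \<rho> lam w"
    using \<rho> by (auto simp: schur_representation_def has_highest_weight_def)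
  obtain \<phi> where dual: "\<And>p q. p \<in> {1..CARD('n)} \<Longrightarrow> q \<in> {1..CARD('n)} \<Longrightarrow>
      pairing (\<phi> p) (e q) = (if p = q then 1 else 0)"
    using ordered_basis_dual[OF ew(1)] by metis
  show thesis
  proof (rule that)
    show "w \<noteq> 0" using ew by (simp add: highest_weight_vector_def)
    show uf: "pairing (\<phi> p) (e p) = 1" using dual[OF p p] by simp
    show "\<rho> (dilation t (e p) (\<phi> p)) *v w = complex_of_real t ^ lam p *s w" if "0 < t" for t
    proof (rule highest_weight_vector_upper_triangular[OF ew(2) _ p])
      show "invertible (dilation t (e p) (\<phi> p))" using that uf by (intro invertible_dilation) auto
      show "upper_triangular_wrt e (\<lambda>i. if i = p then complex_of_real t else 1) (dilation t (e p) (\<phi> p))"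
        using dilation_upper_triangular_functional[of p "\<phi> p" e t] p dual[OF p] by simp
    qed
  qed
qed

section \<open>Degenerate equivariant maps\<close>

text \<open>Abstracts the Pieri map: \<open>M f\<close> contracts the factor \<open>V\<close> with
  the functional \<open>f\<close>. Homogeneity is stated on vectors because \<open>*s\<close> does
  not multiply a matrix by a complex number.\<close>

locale schur_intertwiner =
  fixes \<rho> :: "complex^'n^'n \<Rightarrow> complex^'l^'l" and \<sigma> :: "complex^'n^'n \<Rightarrow> complex^'m^'m"
    and lam mu :: "nat \<Rightarrow> nat" and M :: "complex^'n \<Rightarrow> complex^'m^'l"
  assumes schur_\<rho>: "schur_representation lam \<rho>" and schur_\<sigma>: "schur_representation mu \<sigma>"
    and M_add: "M (f + h) = M f + M h"
    and M_scale: "M (c *s f) *v y = c *s (M f *v y)"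
    and equivariant: "invertible g \<Longrightarrow> M f ** \<sigma> g = \<rho> g ** M (f v* g)"
begin

lemma polynomial_\<rho>: "polynomial_representation \<rho>" and irreducible_\<rho>: "irreducible_representation \<rho>"
  and polynomial_\<sigma>: "polynomial_representation \<sigma>" and irreducible_\<sigma>: "irreducible_representation \<sigma>"
  and representation_\<rho>: "representation \<rho>" and representation_\<sigma>: "representation \<sigma>"
  using schur_\<rho> schur_\<sigma>
  by (auto simp: schur_representation_def polynomial_representation_def)

lemma equivariant_vector: "invertible g \<Longrightarrow> M f *v (\<sigma> g *v y) = \<rho> g *v (M (f v* g) *v y)"
  by (simp add: matrix_vector_mul_assoc equivariant)

text \<open>The functional \<open>f\<close> is an eigenvector of the dilation with eigenvalue
  \<open>t\<close>. The resulting shift of the exponent by one drives both contradictions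
  below.\<close>

lemma equivariant_dilation:
  assumes "pairing f u = 1" "t \<noteq> 0"
  shows "M f *v (\<sigma> (dilation t u f) *v y) = complex_of_real t *s (\<rho> (dilation t u f) *v (M f *v y))"
  using assms by (simp add: equivariant_vector invertible_dilation vector_mult_dilation M_scale vec.scale)

section \<open>Vectors of negligible growth\<close>

definition negligible_growth :: "nat \<Rightarrow> complex^'n \<Rightarrow> complex^'n \<Rightarrow> complex^'l \<Rightarrow> bool" where
  "negligible_growth d u f y \<longleftrightarrow> ((\<lambda>t. inverse (t ^ d) *\<^sub>R (\<rho> (dilation t u f) *v y)) \<longlongrightarrow> 0) at_top"

lemma negligible_growth_0: "negligible_growth d u f 0"
  by (simp add: negligible_growth_def)

lemma negligible_growth_add:
  "negligible_growth d u f x \<Longrightarrow> negligible_growth d u f y \<Longrightarrow> negligible_growth d u f (x + y)"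
  unfolding negligible_growth_def
  by (drule (1) tendsto_add) (simp add: vec.add scaleR_add_right)

lemma tendsto_0_matrix_vector_mult:
  fixes A :: "complex^'b^'a" and h :: "real \<Rightarrow> complex^'b"
  assumes "((\<lambda>t. inverse (t ^ d) *\<^sub>R h t) \<longlongrightarrow> 0) at_top"
  shows "((\<lambda>t. inverse (t ^ d) *\<^sub>R (A *v h t)) \<longlongrightarrow> 0) at_top"
proof -
  have "((\<lambda>t. A *v (inverse (t ^ d) *\<^sub>R h t)) \<longlongrightarrow> A *v 0) at_top"
    by (rule bounded_linear.tendsto[OF matrix_vector_mul_bounded_linear assms])
  then show ?thesis by (simp add: linear_cmul[OF matrix_vector_mul_linear])
qed

lemma negligible_growth_scale:
  assumes "negligible_growth d u f y"
  shows "negligible_growth d u f (c *s y)"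
proof -
  \<comment> \<open>The complex scalar is written as a matrix, to fit
    \<open>tendsto_0_matrix_vector_mult\<close>.\<close>
  have "\<rho> g *v (c *s y) = mat c *v (\<rho> g *v y)" for g
    by (simp add: vec.scale) (simp add: vec_eq_iff matrix_vector_mult_def mat_def if_distrib[of "\<lambda>z. z * _"] cong: if_cong)
  then show ?thesis
    using tendsto_0_matrix_vector_mult[of d "\<lambda>t. \<rho> (dilation t u f) *v y" "mat c"] assms
    by (simp add: negligible_growth_def)
qed

text \<open>A real subspace of a finite dimensional space is closed.\<close>

lemma closed_negligible_growth: "closed {y. negligible_growth d u f y}"
proof (rule closed_subspace, rule subspaceI)
  fix c :: real and y assume "y \<in> {y. negligible_growth d u f y}"
  then have "negligible_growth d u f (complex_of_real c *s y)" by (simp add: negligible_growth_scale)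
  also have "complex_of_real c *s y = c *\<^sub>R y" by (simp add: vec_eq_iff) (simp add: scaleR_conv_of_real)
  finally show "c *\<^sub>R y \<in> {y. negligible_growth d u f y}" by simp
qed (auto intro: negligible_growth_0 negligible_growth_add)

lemma negligible_growth_act:
  assumes uf: "pairing f u = 1" and g: "g ** g' = mat 1" "g' ** g = mat 1"
    and y: "negligible_growth d (g' *v u) (f v* g) y"
  shows "negligible_growth d u f (\<rho> g *v y)"
proof -
  have g_inv: "invertible g" using g by (auto simp: invertible_def)
  have uf': "pairing (f v* g) (g' *v u) = 1" by (simp add: matrix_vector_mul_assoc g uf)
  have "\<rho> (dilation t u f) *v (\<rho> g *v y) = \<rho> g *v (\<rho> (dilation t (g' *v u) (f v* g)) *v y)"
    if "t > 0" for t
  proof -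
    have "\<rho> (dilation t u f) *v (\<rho> g *v y) = \<rho> (dilation t u f ** g) *v y"
      using that g_inv uf by (simp add: representation_mult_vector[OF representation_\<rho>] invertible_dilation)
    also have "\<dots> = \<rho> g *v (\<rho> (dilation t (g' *v u) (f v* g)) *v y)"
      using that g_inv uf'
      by (simp add: dilation_conjugate[OF g(1)] representation_mult_vector[OF representation_\<rho>]
          invertible_dilation del: pairing_vector_matrix_mult)
    finally show ?thesis .
  qed
  then have "\<forall>\<^sub>F t in at_top. inverse (t ^ d) *\<^sub>R (\<rho> g *v (\<rho> (dilation t (g' *v u) (f v* g)) *v y))
      = inverse (t ^ d) *\<^sub>R (\<rho> (dilation t u f) *v (\<rho> g *v y))"
    by (intro eventually_mono[OF eventually_gt_at_top[of 0]]) simp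
  moreover have "((\<lambda>t. inverse (t ^ d) *\<^sub>R (\<rho> g *v (\<rho> (dilation t (g' *v u) (f v* g)) *v y))) \<longlongrightarrow> 0) at_top"
    using y unfolding negligible_growth_def by (rule tendsto_0_matrix_vector_mult)
  ultimately show ?thesis unfolding negligible_growth_def by (blast intro: Lim_transform_eventually)
qed

lemma eventually_shear_inverse: "\<forall>\<^sub>F c in at 0. 1 + pairing f (c *s u) \<noteq> 0"
proof -
  have "((\<lambda>c. 1 + c * pairing f u) \<longlongrightarrow> 1 + 0 * pairing f u) (at 0)" by (intro tendsto_intros)
  then have "\<forall>\<^sub>F c in at 0. 1 + c * pairing f u \<noteq> 0" by (rule tendsto_imp_eventually_ne) simp
  then show ?thesis by simp
qed

text \<open>
  If \<open>M f *v x\<close> stays in a line, then the bound on \<open>\<sigma>\<close> forces an extra factor \<open>1 / t\<close> on a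
  nonzero vector of \<open>\<rho>\<close>, hence on all of them by irreducibility.
\<close>

lemma no_common_image_line:
  assumes mu: "\<And>j. j \<in> {1..CARD('n)} \<Longrightarrow> mu j \<le> lam 1"
    and "w \<noteq> 0" and line: "\<And>f. \<exists>z. M f *v x = z *s w" and h: "M h *v x \<noteq> 0"
  shows False
proof -
  let ?d = "lam 1"
  \<comment> \<open>If \<open>M f *v x = z *s w\<close> with \<open>z\<close> nonzero, equivariance
    bounds \<open>t * norm z * norm (\<rho> (dilation t u f) *v w)\<close> by a multiple of
    \<open>t ^ ?d\<close>.\<close>
  have generic: "negligible_growth ?d u f w" if uf: "pairing f u = 1" and f: "M f *v x \<noteq> 0" for u f
  proof -
    obtain z where z: "M f *v x = z *s w" using line by blast
    obtain K where K: "\<And>t. 1 \<le> t \<Longrightarrow> norm (\<sigma> (dilation t u f) *v x) \<le> K * t ^ ?d"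
      using schur_representation_dilation_bound(1)[OF schur_\<sigma> uf mu] by (metis atLeast_iff)
    obtain B where B: "B > 0" "\<And>y. norm (M f *v y) \<le> norm y * B"
      using bounded_linear.pos_bounded[OF matrix_vector_mul_bounded_linear] by blast
    have z0: "norm z > 0" using f z by auto
    have bound: "norm (inverse (t ^ ?d) *\<^sub>R (\<rho> (dilation t u f) *v w)) \<le> (K * B / norm z) * inverse t"
      if t: "1 \<le> t" for t
    proof -
      have "t * (norm z * norm (\<rho> (dilation t u f) *v w)) = norm (M f *v (\<sigma> (dilation t u f) *v x))"
        using t uf by (simp add: equivariant_dilation z vec.scale norm_scalar_mult norm_mult)
      also have "\<dots> \<le> (K * t ^ ?d) * B"
        using B K[OF t] by (meson less_eq_real_def mult_right_mono order_trans)
      finally show ?thesis using t z0 by (simp add: field_simps)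
    qed
    have "((\<lambda>t. (K * B / norm z) * inverse t) \<longlongrightarrow> 0) at_top"
      by (rule tendsto_mult_right_zero[OF tendsto_inverse_0_at_top[OF filterlim_ident]])
    moreover have "\<forall>\<^sub>F t in at_top. norm (inverse (t ^ ?d) *\<^sub>R (\<rho> (dilation t u f) *v w))
        \<le> (K * B / norm z) * inverse t"
      using eventually_ge_at_top[of 1] by eventually_elim (rule bound)
    ultimately show ?thesis unfolding negligible_growth_def by (rule Lim_null_comparison[rotated])
  qed
  have w_negligible: "negligible_growth ?d u f w" if uf: "pairing f u = 1" for u f
  proof (cases "M f *v x = 0")
    case False
    with uf show ?thesis by (rule generic)
  next
    case True
    \<comment> \<open>A shear moves \<open>f\<close> to \<open>f + c *s h\<close>, where
      \<open>M\<close> no longer kills \<open>x\<close>. Letting \<open>c\<close> tend to 0 and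
      using closedness recovers \<open>w\<close> itself.\<close>
    have "\<forall>\<^sub>F c in at 0. \<rho> (shear (c *s u) h) *v w \<in> {y. negligible_growth ?d u f y}"
      using eventually_shear_inverse[of h u] eventually_neq_at_within[of 0]
    proof eventually_elim
      case (elim c)
      have fh: "f v* shear (c *s u) h = f + c *s h" using uf by simp
      obtain g' where g': "shear (c *s u) h ** g' = mat 1" "g' ** shear (c *s u) h = mat 1"
        using invertible_shear[OF elim(1)] by (auto simp: invertible_def)
      have "pairing (f + c *s h) (g' *v u) = 1"
        unfolding fh[symmetric] by (simp only: pairing_vector_matrix_mult matrix_vector_mul_assoc g'
          matrix_vector_mul_lid uf)
      moreover have "M (f + c *s h) *v x \<noteq> 0"
        using True h elim by (simp add: M_add matrix_vector_mult_add_rdistrib M_scale)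
      ultimately have "negligible_growth ?d (g' *v u) (f v* shear (c *s u) h) w"
        unfolding fh by (rule generic)
      then show ?case using negligible_growth_act[OF uf g'] by simp
    qed
    then have "w \<in> {y. negligible_growth ?d u f y}"
      by (rule Lim_in_closed_set[OF closed_negligible_growth _ _
            polynomial_representation_shear_tendsto[OF polynomial_\<rho>]]) simp
    then show ?thesis by simp
  qed
  \<comment> \<open>This vector grows exactly like \<open>t ^ lam 1\<close> along its dilation, so
    it cannot be negligible.\<close>
  obtain u f w0 where w0: "w0 \<noteq> 0" and uf: "pairing f u = 1"
    and eigen: "\<And>t. 0 < t \<Longrightarrow> \<rho> (dilation t u f) *v w0 = complex_of_real t ^ ?d *s w0"
    by (rule schur_representation_dilation_eigenvector[OF schur_\<rho>, of 1]) (auto simp: Suc_leI)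
  have "\<forall>u f. pairing f u = 1 \<longrightarrow> negligible_growth ?d u f w0"
    using irreducible_\<rho> \<open>w \<noteq> 0\<close>
  proof (induction rule: irreducible_representation_induct)
    case (act g y)
    obtain g' where g': "g ** g' = mat 1" "g' ** g = mat 1" using act(1) by (auto simp: invertible_def)
    show ?case
      using act(2) by (auto intro!: negligible_growth_act[OF _ g'] simp: matrix_vector_mul_assoc g')
  next
    case start
    show ?case using w_negligible by blast
  qed (auto intro: negligible_growth_0 negligible_growth_add negligible_growth_scale)
  then have "((\<lambda>t. inverse (t ^ ?d) *\<^sub>R (\<rho> (dilation t u f) *v w0)) \<longlongrightarrow> 0) at_top"
    using uf by (simp add: negligible_growth_def)
  moreover have "\<forall>\<^sub>F t in at_top. inverse (t ^ ?d) *\<^sub>R (\<rho> (dilation t u f) *v w0) = w0"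
    using eventually_gt_at_top[of 0]
    by eventually_elim ((simp add: eigen vec_eq_iff), (simp add: scaleR_conv_of_real))
  ultimately have "((\<lambda>t::real. w0) \<longlongrightarrow> 0) at_top" by (rule Lim_transform_eventually)
  then show False using w0 by (simp add: tendsto_const_iff)
qed

text \<open>
  The dual situation, with the dilations tending to \<open>0\<close>: here the extra factor \<open>t\<close> kills the
  functional \<open>c\<close> on the orbit of a highest weight vector of \<open>\<sigma>\<close>.
\<close>

lemma no_common_kernel:
  assumes lam: "\<And>j. j \<in> {1..CARD('n)} \<Longrightarrow> mu CARD('n) \<le> lam j"
    and multiple: "\<And>f. \<exists>z. \<forall>y. pairing \<beta> (M f *v y) = z * pairing c y"
    and h: "pairing \<beta> (M h *v y\<^sub>0) \<noteq> 0"
  shows False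
proof -
  let ?d = "mu CARD('n)"
  \<comment> \<open>The exponent is the smallest row of \<open>mu\<close>, the slowest possible
    decay being excluded for \<open>\<rho>\<close> by \<open>lam\<close>.\<close>
  obtain u0 f0 x where x: "x \<noteq> 0" and uf0: "pairing f0 u0 = 1"
    and eigen: "\<And>t. 0 < t \<Longrightarrow> \<sigma> (dilation t u0 f0) *v x = complex_of_real t ^ ?d *s x"
    by (rule schur_representation_dilation_eigenvector[OF schur_\<sigma>, of "CARD('n)"]) (auto simp: Suc_leI)
  have generic: "pairing c (\<sigma> g *v x) = 0"
    if g: "g ** g' = mat 1" "g' ** g = mat 1" and y: "pairing \<beta> (M (f0 v* g') *v y) \<noteq> 0" for g g' y
  proof -
    let ?f = "f0 v* g'" and ?u = "g *v u0"
    have g_inv: "invertible g" using g by (auto simp: invertible_def)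
    have uf: "pairing ?f ?u = 1" by (simp add: matrix_vector_mul_assoc g uf0)
    obtain z where z: "\<And>y. pairing \<beta> (M ?f *v y) = z * pairing c y" using multiple by blast
    have z0: "norm z > 0" using y z by auto
    let ?y = "\<sigma> g *v x"
    obtain K where K: "\<And>t. 0 < t \<Longrightarrow> t \<le> 1 \<Longrightarrow> norm (\<rho> (dilation t ?u ?f) *v (M ?f *v ?y)) \<le> K * t ^ ?d"
      using schur_representation_dilation_bound(2)[OF schur_\<rho> uf lam, of "M ?f *v ?y"]
      by (metis greaterThanAtMost_iff)
    obtain B where B: "B > 0" "\<And>y. norm (pairing \<beta> y) \<le> norm y * B"
    proof -
      have "bounded_linear (pairing \<beta>)"
        unfolding pairing_def by (intro bounded_linear_intros bounded_linear_vec_nth bounded_linear_sum)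
      then show thesis using bounded_linear.pos_bounded that by blast
    qed
    have bound: "norm (z * pairing c ?y) \<le> (K * B) * t" if t: "0 < t" "t \<le> 1" for t
    proof -
      \<comment> \<open>Thus \<open>\<sigma> g *v x\<close> is an eigenvector of the transported
        dilation, again with eigenvalue \<open>t ^ ?d\<close>.\<close>
      have "dilation t ?u ?f ** g = g ** dilation t u0 f0"
        using dilation_conjugate[OF g(1), of t ?u ?f]
        by (simp add: matrix_vector_mul_assoc vector_matrix_mul_assoc g)
      then have "\<sigma> (dilation t ?u ?f) *v ?y = \<sigma> g *v (\<sigma> (dilation t u0 f0) *v x)"
        using t uf uf0 g_inv by (simp add: invertible_dilation flip: representation_mult_vector[OF representation_\<sigma>])
      also have "\<dots> = complex_of_real t ^ ?d *s ?y" using t by (simp add: eigen vec.scale)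
      finally have "t ^ ?d * norm (z * pairing c ?y)
          = norm (pairing \<beta> (M ?f *v (\<sigma> (dilation t ?u ?f) *v ?y)))"
        using t by (simp add: z norm_mult norm_power)
      also have "\<dots> = t * norm (pairing \<beta> (\<rho> (dilation t ?u ?f) *v (M ?f *v ?y)))"
        using t uf by (simp add: equivariant_dilation norm_mult del: pairing_vector_matrix_mult)
      also have "\<dots> \<le> t * ((K * t ^ ?d) * B)"
        using B K[OF t] t by (meson less_eq_real_def mult_left_mono mult_right_mono order_trans)
      finally show ?thesis using t by (simp add: field_simps)
    qed
    \<comment> \<open>After division by \<open>t ^ ?d\<close> the extra factor \<open>t\<close>
      remains and tends to 0.\<close>
    have "((\<lambda>t. (K * B) * t) \<longlongrightarrow> (K * B) * 0) (at_right 0)" by (intro tendsto_intros)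
    moreover have "\<forall>\<^sub>F t in at_right 0. norm (z * pairing c ?y) \<le> (K * B) * t"
      by (rule eventually_at_rightI[of 0 1]) (auto intro!: bound simp del: norm_mult)
    ultimately have "norm (z * pairing c ?y) \<le> (K * B) * 0"
      by (intro tendsto_lowerbound) auto
    then show ?thesis using z0 by auto
  qed
  have orbit: "pairing c (\<sigma> g *v x) = 0" if g_inv: "invertible g" for g
  proof -
    obtain g' where g: "g ** g' = mat 1" "g' ** g = mat 1" using g_inv unfolding invertible_def by blast
    show ?thesis
    proof (cases "\<exists>y. pairing \<beta> (M (f0 v* g') *v y) \<noteq> 0")
      case True
      then show ?thesis using generic[OF g] by blast
    next
      case False
      let ?f = "f0 v* g'" and ?u = "g *v u0"
      have uf: "pairing ?f ?u = 1" by (simp add: matrix_vector_mul_assoc g uf0)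
      have "\<forall>\<^sub>F s in at 0. \<sigma> (shear (s *s ?u) h) *v (\<sigma> g *v x) \<in> {y. pairing c y = 0}"
        using eventually_shear_inverse[of h ?u] eventually_neq_at_within[of 0]
      proof eventually_elim
        case (elim s)
        \<comment> \<open>The coefficient of the inverse shear. Since \<open>?f\<close> is 1 on
          \<open>?u\<close>, replacing \<open>g\<close> by \<open>?p ** g\<close> changes the
          functional to \<open>?f + r *s h\<close>, to which \<open>generic\<close> applies.\<close>
        define r where "r = - (s / (1 + pairing h (s *s ?u)))"
        have r: "r \<noteq> 0" using elim by (simp add: r_def)
        let ?p = "shear (s *s ?u) h" and ?p' = "shear (r *s ?u) h"
        have p: "?p ** ?p' = mat 1" "?p' ** ?p = mat 1"
          using shear_inverse[OF elim(1)] by (simp_all add: r_def vec_eq_iff)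
        have pg: "(?p ** g) ** (g' ** ?p') = mat 1" "(g' ** ?p') ** (?p ** g) = mat 1"
          using p g by (metis matrix_mul_assoc matrix_mul_lid)+
        have "f0 v* (g' ** ?p') = ?f + r *s h"
          using uf by (simp add: vector_matrix_mul_assoc[symmetric] vec.scale del: pairing_vector_matrix_mult)
        moreover have "pairing \<beta> (M (?f + r *s h) *v y\<^sub>0) \<noteq> 0"
          using False h r by (simp add: M_add matrix_vector_mult_add_rdistrib M_scale)
        ultimately have "pairing c (\<sigma> (?p ** g) *v x) = 0"
          using generic[OF pg] by simp
        then show ?case
          using invertible_shear[OF elim(1)] g_inv by (simp add: representation_mult_vector[OF representation_\<sigma>])
      qed
      moreover have "closed {y. pairing c y = 0}"
        unfolding pairing_def by (intro closed_Collect_eq continuous_intros)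
      ultimately have "\<sigma> g *v x \<in> {y. pairing c y = 0}"
        by (intro Lim_in_closed_set[OF _ _ _ polynomial_representation_shear_tendsto[OF polynomial_\<sigma>]])
           auto
      then show ?thesis by simp
    qed
  qed
  \<comment> \<open>Quantifying over \<open>g\<close> makes the vanishing of \<open>c\<close> an
    invariant property; it spreads from \<open>x\<close> to all vectors.\<close>
  have "\<forall>g. invertible g \<longrightarrow> pairing c (\<sigma> g *v y\<^sub>0) = 0"
    using irreducible_\<sigma> x
  proof (induction rule: irreducible_representation_induct)
    case (act g y)
    then show ?case
      by (simp add: invertible_mult flip: representation_mult_vector[OF representation_\<sigma>])
  qed (auto simp: vec.add vec.scale orbit)
  then have "pairing c (\<sigma> (mat 1) *v y\<^sub>0) = 0" using invertible_shear[of 0 "0 :: complex^'n"] by simp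
  moreover have "\<sigma> (mat 1) = mat 1" using representation_\<sigma> by (simp add: representation_def)
  ultimately have "pairing c y\<^sub>0 = 0" by simp
  then show False using multiple[of h] h by auto
qed

text \<open>
  A linear space of maps of rank at most one has a common image line or a common kernel.
\<close>

lemma not_all_rank_one:
  assumes mu: "\<And>j. j \<in> {1..CARD('n)} \<Longrightarrow> mu j \<le> lam 1"
    and lam: "\<And>j. j \<in> {1..CARD('n)} \<Longrightarrow> mu CARD('n) \<le> lam j"
    and rank_one: "\<And>f. \<exists>c b. \<forall>y. M f *v y = pairing c y *s b"
    and nonzero: "M h *v x \<noteq> 0"
  shows False
proof (cases "\<forall>f y. \<exists>z. M f *v y = z *s (M h *v x)")
  case True
  then show False using no_common_image_line[OF mu nonzero _ nonzero] by blast
next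
  case False
  obtain c1 b1 where 1: "\<And>y. M h *v y = pairing c1 y *s b1" using rank_one by metis
  obtain f2 y2 where not_line: "\<And>z. M f2 *v y2 \<noteq> z *s (M h *v x)" using False by blast
  obtain c2 b2 where 2: "\<And>y. M f2 *v y = pairing c2 y *s b2" using rank_one by metis
  have c1x: "pairing c1 x \<noteq> 0" and b1: "b1 \<noteq> 0" using nonzero 1 by auto
  have indep: "b2 \<noteq> z *s b1" for z
    using not_line[of "pairing c2 y2 * z / pairing c1 x"] c1x by (auto simp: 1 2)
  have b2: "b2 \<noteq> 0" and c2: "pairing c2 y2 \<noteq> 0"
    using indep[of 0] not_line[of 0] 2 by auto
  have indep': "b1 \<noteq> z *s b2" for z
    using indep[of "1 / z"] b1 by (cases "z = 0") auto
  have parallel: "\<exists>z. M f *v y' = z *s (M f *v y)" if "M f *v y \<noteq> 0" for f y y'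
  proof -
    obtain c b where cb: "\<And>y. M f *v y = pairing c y *s b" using rank_one by metis
    then have "M f *v y' = (pairing c y' / pairing c y) *s (M f *v y)"
      using that by auto
    then show ?thesis by blast
  qed
  have sum: "M (f + f') *v y = M f *v y + M f' *v y" for f f' y
    by (simp add: M_add matrix_vector_mult_add_rdistrib)
  have line_through: "\<exists>z. a = z *s b" if "p *s a + q *s b = z *s (r *s b)" "p \<noteq> 0"
    for a b :: "complex^'l" and p q r z
  proof
    show "a = ((z * r - q) / p) *s b"
      using that by (simp add: vec_eq_iff field_simps)
  qed
  \<comment> \<open>Otherwise the image line of \<open>M (h + f2)\<close> would contain both
    \<open>b2\<close> and, from its value at \<open>x\<close>, \<open>b1\<close>.\<close>
  have ker: "pairing c2 y = 0" if y: "pairing c1 y = 0" for y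
  proof (rule ccontr)
    assume c2y: "pairing c2 y \<noteq> 0"
    then have "M (h + f2) *v y \<noteq> 0" using y b2 by (simp add: sum 1 2)
    from parallel[OF this, of x] y obtain z
      where "pairing c1 x *s b1 + pairing c2 x *s b2 = z *s (pairing c2 y *s b2)"
      by (auto simp: sum 1 2)
    from line_through[OF this c1x] indep' show False by blast
  qed
  \<comment> \<open>Otherwise the same argument with \<open>h + f\<close> and with
    \<open>f2 + f\<close> puts both \<open>b1\<close> and \<open>b2\<close> on the line of
    \<open>b3\<close>.\<close>
  have kernel: "M f *v y = 0" if y: "pairing c1 y = 0" for f y
  proof (rule ccontr)
    assume fy: "M f *v y \<noteq> 0"
    obtain c3 b3 where 3: "\<And>y. M f *v y = pairing c3 y *s b3" using rank_one by metis
    have c3y: "pairing c3 y \<noteq> 0" "b3 \<noteq> 0" using fy 3 by auto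
    have "M (h + f) *v y \<noteq> 0" using y fy by (simp add: sum 1)
    from parallel[OF this, of x] y obtain z
      where "pairing c1 x *s b1 + pairing c3 x *s b3 = z *s (pairing c3 y *s b3)"
      by (auto simp: sum 1 3)
    from line_through[OF this c1x] obtain z1 where z1: "b1 = z1 *s b3" by blast
    have "M (f2 + f) *v y \<noteq> 0" using ker[OF y] fy by (simp add: sum 2)
    from parallel[OF this, of y2] ker[OF y] obtain z
      where "pairing c2 y2 *s b2 + pairing c3 y2 *s b3 = z *s (pairing c3 y *s b3)"
      by (auto simp: sum 2 3)
    from line_through[OF this c2] obtain z2 where z2: "b2 = z2 *s b3" by blast
    have "z1 \<noteq> 0" using z1 b1 by auto
    then have "b2 = (z2 / z1) *s b1" using z1 z2 by simp
    then show False using indep by blast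
  qed
  obtain \<beta> where \<beta>: "pairing \<beta> b1 = 1" using ex_pairing_left_eq_1[OF b1] by blast
  have "\<exists>z. \<forall>y. pairing \<beta> (M f *v y) = z * pairing c1 y" for f
  proof (intro exI allI)
    fix y
    \<comment> \<open>Subtracting this multiple of \<open>x\<close> lands in the kernel of
      \<open>c1\<close>, so \<open>M f\<close> is determined by its value at
      \<open>x\<close>.\<close>
    have "M f *v (y - (pairing c1 y / pairing c1 x) *s x) = 0"
      using c1x by (intro kernel) simp
    then have "M f *v y = (pairing c1 y / pairing c1 x) *s (M f *v x)"
      by (simp add: vec.diff vec.scale)
    then show "pairing \<beta> (M f *v y) = (pairing \<beta> (M f *v x) / pairing c1 x) * pairing c1 y"
      by simp
  qed
  moreover have "pairing \<beta> (M h *v x) \<noteq> 0" using 1 \<beta> c1x by simp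
  ultimately show False using no_common_kernel lam by blast
qed

text \<open>The group acts transitively on nonzero functionals, and equivariance carries the rank
  one form from \<open>\<alpha>\<close> to \<open>f\<close>.\<close>

lemma rank_one_transitive:
  assumes \<alpha>: "\<alpha> \<noteq> 0" and rank_one: "\<And>y. M \<alpha> *v y = pairing c y *s b"
  shows "\<exists>c b. \<forall>y. M f *v y = pairing c y *s b"
proof (cases "f = 0")
  case True
  have "M 0 *v y = 0 *s 0" for y using M_scale[of 0 0 y] by simp
  then show ?thesis using True by auto
next
  case False
  obtain u1 u2 where u: "pairing \<alpha> u1 = 1" "pairing f u2 = 1"
    using ex_pairing_right_eq_1 \<alpha> False by blast
  \<comment> \<open>Two hyperplanes do not cover the space.\<close>
  have "\<exists>u. pairing \<alpha> u \<noteq> 0 \<and> pairing f u \<noteq> 0"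
  proof (rule ccontr)
    assume no: "\<not> ?thesis"
    have "pairing f u1 = 0" "pairing \<alpha> u2 = 0" using no u by (metis zero_neq_one)+
    then have "pairing \<alpha> (u1 + u2) = 1" "pairing f (u1 + u2) = 1" using u by auto
    then show False using no by (metis zero_neq_one)
  qed
  then obtain u' where u': "pairing \<alpha> u' \<noteq> 0" "pairing f u' \<noteq> 0" by blast
  define u where "u = (1 / pairing \<alpha> u') *s u'"
  have \<alpha>u: "pairing \<alpha> u = 1" and fu: "pairing f u \<noteq> 0" using u' by (simp_all add: u_def)
  \<comment> \<open>As \<open>pairing \<alpha> u = 1\<close>, this shear carries
    \<open>\<alpha>\<close> to \<open>f\<close>; it is invertible because
    \<open>1 + pairing (f - \<alpha>) u\<close> is \<open>pairing f u\<close>.\<close>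
  define g where "g = shear u (f - \<alpha>)"
  have g: "invertible g" unfolding g_def using \<alpha>u fu by (intro invertible_shear) simp
  then obtain g' where g': "g ** g' = mat 1" "g' ** g = mat 1" unfolding invertible_def by blast
  then have g'_inv: "invertible g'" unfolding invertible_def by blast
  have \<alpha>g: "\<alpha> v* g = f" by (simp add: g_def \<alpha>u)
  have "M f *v y = pairing (c v* \<sigma> g) y *s (\<rho> g' *v b)" for y
  proof -
    have "M f *v y = \<rho> g' *v (\<rho> g *v (M (\<alpha> v* g) *v y))"
      using g g'_inv representation_\<rho>
      by (simp add: g' \<alpha>g representation_def flip: representation_mult_vector[OF representation_\<rho>])
    also have "\<dots> = \<rho> g' *v (M \<alpha> *v (\<sigma> g *v y))" using g by (simp only: equivariant_vector)
    also have "\<dots> = pairing (c v* \<sigma> g) y *s (\<rho> g' *v b)" by (simp add: rank_one vec.scale)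
    finally show ?thesis .
  qed
  then show ?thesis by blast
qed

end

section \<open>The tensor of a Pieri map\<close>

definition flattening :: "complex^'c^'b^'a \<Rightarrow> complex^'a \<Rightarrow> complex^'c^'b" where
  "flattening T f = (\<chi> j k. \<Sum>i\<in>UNIV. f $ i * T $ i $ j $ k)"

lemma flattening_add: "flattening T (f + h) = flattening T f + flattening T h"
  by (simp add: flattening_def vec_eq_iff sum.distrib distrib_right)

lemma flattening_scale: "flattening T (c *s f) *v y = c *s (flattening T f *v y)"
  by (simp add: flattening_def vec_eq_iff matrix_vector_mult_def sum_distrib_left sum_distrib_right mult_ac)

lemma flattening_mult_vector_nth:
  "(flattening T f *v y) $ j = (\<Sum>i\<in>UNIV. f $ i * (\<Sum>k\<in>UNIV. y $ k * T $ i $ j $ k))"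
  unfolding flattening_def matrix_vector_mult_def
  by (simp add: sum_distrib_left sum_distrib_right mult_ac) (rule sum.swap)

text \<open>The sum over \<open>j\<close> is innermost so that an assumption on the contraction with
  \<open>\<beta>\<close> can rewrite it.\<close>

lemma pairing_flattening_mult_vector:
  "pairing \<beta> (flattening T f *v y) = (\<Sum>i\<in>UNIV. f $ i * (\<Sum>k\<in>UNIV. y $ k * (\<Sum>j\<in>UNIV. \<beta> $ j * T $ i $ j $ k)))"
proof -
  have "pairing \<beta> (flattening T f *v y) = (\<Sum>j\<in>UNIV. \<Sum>i\<in>UNIV. \<Sum>k\<in>UNIV. f $ i * (y $ k * (\<beta> $ j * T $ i $ j $ k)))"
    by (simp add: pairing_def flattening_mult_vector_nth sum_distrib_left mult_ac)
  also have "\<dots> = (\<Sum>i\<in>UNIV. \<Sum>j\<in>UNIV. \<Sum>k\<in>UNIV. f $ i * (y $ k * (\<beta> $ j * T $ i $ j $ k)))"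
    by (rule sum.swap)
  also have "\<dots> = (\<Sum>i\<in>UNIV. \<Sum>k\<in>UNIV. \<Sum>j\<in>UNIV. f $ i * (y $ k * (\<beta> $ j * T $ i $ j $ k)))"
    by (intro sum.cong refl sum.swap)
  finally show ?thesis by (simp add: sum_distrib_left)
qed

text \<open>Frees the tensor from the basis used to define it: the flattening is \<open>P\<close>
  followed by contraction of the factor \<open>V\<close> with \<open>f\<close>.\<close>

lemma flattening_pieri_tensor_mult_vector:
  fixes P :: "complex^'m \<Rightarrow> complex^('l::finite \<times> 'n::finite)"
  assumes "Vector_Spaces.linear (*s) (*s) P"
  shows "(flattening (pieri_tensor P) f *v y) $ j = (\<Sum>i\<in>UNIV. f $ i * P y $ (j, i))"
proof -
  have "P y = P (\<Sum>k\<in>UNIV. y $ k *s axis k 1)" by (simp add: basis_expansion)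
  also have "\<dots> = (\<Sum>k\<in>UNIV. y $ k *s P (axis k 1))"
    by (simp add: vec.linear_sum[OF assms] vec.linear_scale[OF assms])
  finally have "P y $ (j, i) = (\<Sum>k\<in>UNIV. y $ k * P (axis k 1) $ (j, i))" for i
    by simp
  then show ?thesis by (simp add: flattening_mult_vector_nth pieri_tensor_def)
qed

text \<open>The factor \<open>g\<close> acting on \<open>V\<close> in the Kronecker product is moved
  onto the functional by reordering the sums.\<close>

lemma flattening_pieri_tensor_equivariant:
  assumes P: "pieri_map \<rho> \<sigma> P" and g: "invertible g"
  shows "flattening (pieri_tensor P) f ** \<sigma> g = \<rho> g ** flattening (pieri_tensor P) (f v* g)"
proof -
  have lin: "Vector_Spaces.linear (*s) (*s) P" and equi: "\<And>u. P (\<sigma> g *v u) = kronecker (\<rho> g) g *v P u"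
    using P g by (auto simp: pieri_map_def)
  have "(flattening (pieri_tensor P) f *v (\<sigma> g *v y)) $ j
      = (\<rho> g *v (flattening (pieri_tensor P) (f v* g) *v y)) $ j" for y j
  proof -
    have "(flattening (pieri_tensor P) f *v (\<sigma> g *v y)) $ j
      = (\<Sum>i\<in>UNIV. \<Sum>j'\<in>UNIV. \<Sum>i'\<in>UNIV. f $ i * (\<rho> g $ j $ j' * g $ i $ i' * P y $ (j', i')))"
      unfolding flattening_pieri_tensor_mult_vector[OF lin] equi
      by (simp add: matrix_vector_mult_def kronecker_def sum.cartesian_product sum_distrib_left case_prod_beta
          flip: UNIV_Times_UNIV)
    also have "\<dots> = (\<Sum>j'\<in>UNIV. \<Sum>i\<in>UNIV. \<Sum>i'\<in>UNIV. f $ i * (\<rho> g $ j $ j' * g $ i $ i' * P y $ (j', i')))"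
      by (rule sum.swap)
    also have "\<dots> = (\<Sum>j'\<in>UNIV. \<Sum>i'\<in>UNIV. \<Sum>i\<in>UNIV. f $ i * (\<rho> g $ j $ j' * g $ i $ i' * P y $ (j', i')))"
      by (intro sum.cong refl sum.swap)
    also have "\<dots> = (\<rho> g *v (flattening (pieri_tensor P) (f v* g) *v y)) $ j"
      by (simp add: matrix_vector_mult_def[of "\<rho> g"] flattening_pieri_tensor_mult_vector[OF lin]
          vector_matrix_mult_def sum_distrib_left sum_distrib_right mult_ac)
    finally show ?thesis .
  qed
  then show ?thesis by (simp add: matrix_eq vec_eq_iff flip: matrix_vector_mul_assoc)
qed

theorem theorem1p1:
  fixes \<rho> :: "complex^'n^'n \<Rightarrow> complex^'l^'l"
    and \<sigma> :: "complex^'n^'n \<Rightarrow> complex^'m^'m"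
    and P :: "complex^'m \<Rightarrow> complex^('l \<times> 'n)"
    and lam mu :: "nat \<Rightarrow> nat" and k n :: nat
  assumes "CARD('n) = n"
    and "partition_with_rows n lam" and "partition_with_rows n mu"
    and "adds_box k lam mu" and "k \<noteq> 1" and "k \<noteq> n"
    and "schur_representation lam \<rho>" and "schur_representation mu \<sigma>"
    and "pieri_map \<rho> \<sigma> P"
  shows "\<not> minimal_border_rank (pieri_tensor P)"
proof
  let ?T = "pieri_tensor P"
  assume min: "minimal_border_rank ?T"
  then have concise: "concise ?T" by (simp add: minimal_border_rank_def)
  interpret schur_intertwiner \<rho> \<sigma> lam mu "flattening ?T"
    using assms flattening_pieri_tensor_equivariant[OF assms(9)]
    by unfold_locales (auto simp: flattening_add flattening_scale)
  have n: "1 \<le> n" using assms(1) by (metis One_nat_def Suc_leI zero_less_card_finite)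
  \<comment> \<open>The added box lies in neither the first nor the last row, so the extreme rows
    agree.\<close>
  have mu1: "mu 1 = lam 1" and mun: "mu n = lam n" using assms n by (auto simp: adds_box_def)
  have mu_le: "mu j \<le> lam 1" if "j \<in> {1..CARD('n)}" for j
    using assms(3) that unfolding mu1[symmetric] by (auto simp: partition_with_rows_def)
  have lam_ge: "mu CARD('n) \<le> lam j" if "j \<in> {1..CARD('n)}" for j
    using assms(2) that unfolding assms(1) mun by (auto simp: partition_with_rows_def)
  from min show False
  proof (cases rule: minimal_border_rank_cases)
    case (first \<alpha> b c)
    have "inj (\<lambda>\<alpha>. flattening ?T \<alpha>)" using concise by (simp add: concise_def flattening_def)
    then have "flattening ?T \<alpha> \<noteq> flattening ?T 0" using first(1) by (simp add: inj_eq)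
    then obtain x where x: "flattening ?T \<alpha> *v x \<noteq> 0"
      using M_scale[of 0 0] by (auto simp: matrix_eq)
    have "flattening ?T \<alpha> *v y = pairing c y *s b" for y
      by (simp add: vec_eq_iff matrix_vector_mult_def flattening_def first(2) pairing_def sum_distrib_left mult_ac)
    \<comment> \<open>One contraction of rank one makes all of them have rank at most one.\<close>
    then have "\<exists>c b. \<forall>y. flattening ?T f *v y = pairing c y *s b" for f
      by (rule rank_one_transitive[OF first(1)])
    then show False using not_all_rank_one mu_le lam_ge x by blast
  next
    case (second \<beta> a c)
    \<comment> \<open>The functional \<open>c\<close> is common to all \<open>f\<close>; only the
      scalar \<open>pairing f a\<close> varies.\<close>
    have eq: "pairing \<beta> (flattening ?T f *v y) = pairing f a * pairing c y" for f y
      by (simp add: pairing_flattening_mult_vector second(2))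
         (simp add: pairing_def sum_product sum_distrib_left mult_ac)
    have inj: "inj (\<lambda>\<beta>::complex^'l. (\<chi> i k. \<Sum>j\<in>UNIV. \<beta> $ j * ?T $ i $ j $ k) :: complex^'m^'n)"
      using concise by (simp add: concise_def)
    have "(\<chi> i k. \<Sum>j\<in>UNIV. \<beta> $ j * ?T $ i $ j $ k) \<noteq> (0 :: complex^'m^'n)"
      using inj_onD[OF inj, of \<beta> 0] second(1) by (auto simp: vec_eq_iff)
    then obtain i k where "a $ i * c $ k \<noteq> 0" by (auto simp: vec_eq_iff second(2))
    then have "pairing \<beta> (flattening ?T (axis i 1) *v axis k 1) \<noteq> 0" by (simp add: eq)
    moreover have "\<exists>z. \<forall>y. pairing \<beta> (flattening ?T f *v y) = z * pairing c y" for f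
      using eq by blast
    ultimately show False using no_common_kernel lam_ge by blast
  next
    case (third \<gamma> a b)
    \<comment> \<open>All values at \<open>\<gamma>\<close> lie on the line of \<open>b\<close>;
      conciseness makes one of them nonzero.\<close>
    have eq: "flattening ?T f *v \<gamma> = pairing f a *s b" for f
      by (simp add: vec_eq_iff flattening_mult_vector_nth third(2) pairing_def sum_distrib_left mult_ac)
    have inj: "inj (\<lambda>\<gamma>::complex^'m. (\<chi> i j. \<Sum>k\<in>UNIV. \<gamma> $ k * ?T $ i $ j $ k) :: complex^'l^'n)"
      using concise by (simp add: concise_def)
    have "(\<chi> i j. \<Sum>k\<in>UNIV. \<gamma> $ k * ?T $ i $ j $ k) \<noteq> (0 :: complex^'l^'n)"
      using inj_onD[OF inj, of \<gamma> 0] third(1) by (auto simp: vec_eq_iff)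
    then obtain i j where ij: "a $ i * b $ j \<noteq> 0" by (auto simp: vec_eq_iff third(2))
    then have "b \<noteq> 0" by auto
    moreover have "flattening ?T (axis i 1) *v \<gamma> \<noteq> 0" using ij \<open>b \<noteq> 0\<close> by (simp add: eq)
    ultimately show False using eq by (intro no_common_image_line[OF mu_le]) blast+
  qed
qed

end
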